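(* Let $\mathcal{P}$ be a set of probability distributions on $\mathcal{Z}=\mathcal{X}\times\mathcal{Y}$ containing a hypercube of distributions of characteristic function $\tilde\psi$ and representatives $P_{[-]}$ and $P_{[+]}$. For any training set size $n\in\mathbb{N}^*$ and any estimator $\hat g$, we have $$\sup_{P\in\mathcal{P}}\left\{\mathbb{E}R(\hat g)-\min_gR(g)\right\}\ge\mathcal{S}_{\tilde\psi}\left(P_{[+]}^{\otimes n},P_{[-]}^{\otimes n}\right),$$ where the minimum is taken over the space of all prediction functions and $\mathbb{E}R(\hat g)=\mathbb{E}_{Z_1^n\sim P^{\otimes n}}\mathbb{E}_{(X,Y)\sim P}\,\ell[Y,\hat g_{Z_1^n}(X)]$ denotes the expected risk of the estimator $\hat g$ trained on a sample of size $n$.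
   Context: Setting. The loss is of the form $L[(x,y),g]=\ell[y,g(x)]$ for some function $\ell:\mathcal{Y}\times\mathcal{Y}\to\mathbb{R}$. Prediction functions are measurable functions $\mathcal{X}\to\mathcal{Y}$; $R(g)=\mathbb{E}_{(X,Y)\sim P}\ell[Y,g(X)]$. An estimator $\hat g$ maps a training set $Z_1^n\in\mathcal{Z}^n$ to a prediction function $\hat g_{Z_1^n}$ (measurability is implicitly assumed). $P^{\otimes n}$ is the $n$-fold product of $P$. Hypercube. Let $m\in\mathbb{N}^*$. A hypercube of probability distributions is a family of $2^m$ distributions $\{P_{\bar\sigma}:\bar\sigma=(\sigma_1,\dots,\sigma_m)\in\{-;+\}^m\}$ on $\mathcal{Z}$ having the same first marginal $P_{\bar\sigma}(dX)=\mu(dX)$ and such that there exist a partition $\mathcal{X}_0,\dots,\mathcal{X}_m$ of $\mathcal{X}$ with $\mu(\mathcal{X}_1)=\dots=\mu(\mathcal{X}_m)$, elements $h_1\ne h_2$ of $\mathcal{Y}$, and reals $0\le p_-<p_+\le1$, for which for any $j\in\{1,\dots,m\}$ and $x\in\mathcal{X}_j$, $P_{\bar\sigma}(Y=h_1|X=x)=p_{\sigma_j}=1-P_{\bar\sigma}(Y=h_2|X=x)$, and for any $x\in\mathcal{X}_0$ the distribution of $Y$ knowing $X=x$ is independent of $\bar\sigma$. The edge probability is $w=\mu(\mathcal{X}_1)=\dots=\mu(\mathcal{X}_m)$. Characteristic function. For $p\in[0;1]$, let $\varphi_p(y)=p\,\ell(h_1,y)+(1-p)\,\ell(h_2,y)$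 and $\phi(p)=\inf_{y\in\mathcal{Y}}\varphi_p(y)$. For $q_+,q_-\in[0;1]$, $\psi_{q_+,q_-}(\alpha)=\phi[\alpha q_++(1-\alpha)q_-]-\alpha\phi(q_+)-(1-\alpha)\phi(q_-)$. The characteristic function of the hypercube is the (concave, nonnegative) function $\tilde\psi:\mathbb{R}_+\to\mathbb{R}_+$, $\tilde\psi(u)=\frac{mw}{2}(u+1)\,\psi_{p_+,p_-}\left(\frac{u}{u+1}\right)$. Representatives. A base $P_0$ of the hypercube is a probability distribution on $\mathcal{Z}$ with $P_0(dX)=\mu(dX)$ and, for any $x\in\mathcal{X}-\mathcal{X}_0$, $P_0[Y=h_1|X=x]=\frac12=P_0[Y=h_2|X=x]$. The representatives $P_{[\sigma]}$, $\sigma\in\{-,+\}$, are the distributions whose density with respect to $P_0$ at $(x,y)$ equals $2p_\sigma$ when $x\in\mathcal{X}_1$ and $y=h_1$, equals $2[1-p_\sigma]$ when $x\in\mathcal{X}_1$ and $y=h_2$, and equals $1$ otherwise. Similarity. For a concave $f:\mathbb{R}_+\to\mathbb{R}_+$ and probability distributions $\mathbb{P},\mathbb{Q}$, the $f$-similarity is $\mathcal{S}_f(\mathbb{P},\mathbb{Q})=\int f\left(\frac{\mathbb{P}}{\mathbb{Q}}\right)d\mathbb{Q}$ if $\mathbb{P}\ll\mathbb{Q}$, where $\frac{\mathbb{P}}{\mathbb{Q}}$ denotes the density, and $\mathcal{S}_f(\mathbb{P},\mathbb{Q})=f(0)$ otherwise. *)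

theory Defs
  imports "HOL-Probability.Probability"
begin

text \<open>
  The input space \<open>\<X>\<close> and the output space \<open>\<Y>\<close> are measurable spaces, represented by (the
  carrier and the sigma-algebra of) \<open>M :: 'x measure\<close> and \<open>N :: 'y measure\<close>; the measures they
  carry play no role. Data points live in \<open>M \<Otimes>\<^sub>M N\<close>, and prediction functions are the
  elements of \<open>M \<rightarrow>\<^sub>M N\<close>.
\<close>

text \<open>
  Extended-real expectation: positive part minus negative part. It is only meaningful if one of
  the two parts has a finite integral.
\<close>

definition ereal_expectation :: "'a measure \<Rightarrow> ('a \<Rightarrow> ereal) \<Rightarrow> ereal" where
  "ereal_expectation Q f =
     enn2ereal (\<integral>\<^sup>+z. e2ennreal (f z) \<partial>Q) - enn2ereal (\<integral>\<^sup>+z. e2ennreal (- f z) \<partial>Q)"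

definition risk :: "('y \<Rightarrow> 'y \<Rightarrow> real) \<Rightarrow> ('x \<times> 'y) measure \<Rightarrow> ('x \<Rightarrow> 'y) \<Rightarrow> ereal" where
  "risk loss P g = ereal_expectation P (\<lambda>(x, y). ereal (loss y (g x)))"

definition optimal_risk ::
  "'x measure \<Rightarrow> 'y measure \<Rightarrow> ('y \<Rightarrow> 'y \<Rightarrow> real) \<Rightarrow> ('x \<times> 'y) measure \<Rightarrow> ereal" where
  "optimal_risk M N loss P = (INF g \<in> M \<rightarrow>\<^sub>M N. risk loss P g)"

text \<open>
  The implicit requirement for excess risks \<open>R(g) - min R\<close> to make sense under \<open>P\<close>: all risks
  exist in \<open>(-\<infinity>, \<infinity>]\<close>, and the optimal risk is finite. Individual risks may be \<open>\<infinity>\<close>.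
\<close>

definition excess_risk_well_defined ::
  "'x measure \<Rightarrow> 'y measure \<Rightarrow> ('y \<Rightarrow> 'y \<Rightarrow> real) \<Rightarrow> ('x \<times> 'y) measure \<Rightarrow> bool" where
  "excess_risk_well_defined M N loss P \<longleftrightarrow>
     (\<forall>g \<in> M \<rightarrow>\<^sub>M N. (\<integral>\<^sup>+(x, y). ennreal (- loss y (g x)) \<partial>P) < \<infinity>) \<and>
     \<bar>optimal_risk M N loss P\<bar> \<noteq> \<infinity>"

text \<open>
  A training set of size \<open>n\<close> is an element \<open>z\<close> of the product space over the index set
  \<open>{1..n}\<close>. Joint measurability makes each \<open>ghat z\<close> a prediction function.
\<close>

definition training_distr :: "nat \<Rightarrow> 'z measure \<Rightarrow> (nat \<Rightarrow> 'z) measure" where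
  "training_distr n P = (\<Pi>\<^sub>M i\<in>{1..n}. P)"

definition estimator ::
  "'x measure \<Rightarrow> 'y measure \<Rightarrow> nat \<Rightarrow> ((nat \<Rightarrow> 'x \<times> 'y) \<Rightarrow> 'x \<Rightarrow> 'y) \<Rightarrow> bool" where
  "estimator M N n ghat \<longleftrightarrow>
     (\<lambda>(z, x). ghat z x) \<in> (\<Pi>\<^sub>M i\<in>{1..n}. M \<Otimes>\<^sub>M N) \<Otimes>\<^sub>M M \<rightarrow>\<^sub>M N"

definition expected_risk ::
  "('y \<Rightarrow> 'y \<Rightarrow> real) \<Rightarrow> ('x \<times> 'y) measure \<Rightarrow> nat \<Rightarrow> ((nat \<Rightarrow> 'x \<times> 'y) \<Rightarrow> 'x \<Rightarrow> 'y) \<Rightarrow> ereal" where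
  "expected_risk loss P n ghat =
     ereal_expectation (training_distr n P) (\<lambda>z. risk loss P (ghat z))"

datatype sign = Minus | Plus

text \<open>\<open>\<kappa> x\<close> is the distribution of \<open>Y\<close> knowing \<open>X = x\<close> (a regular conditional distribution).\<close>

definition is_cond_distr ::
  "'x measure \<Rightarrow> 'y measure \<Rightarrow> ('x \<times> 'y) measure \<Rightarrow> ('x \<Rightarrow> 'y measure) \<Rightarrow> bool" where
  "is_cond_distr M N P \<kappa> \<longleftrightarrow>
     \<kappa> \<in> M \<rightarrow>\<^sub>M prob_algebra N \<and>
     (\<forall>A \<in> sets M. \<forall>B \<in> sets N.
        emeasure P (A \<times> B) = (\<integral>\<^sup>+x\<in>A. emeasure (\<kappa> x) B \<partial>distr P M fst))"

definition sign_vectors :: "nat \<Rightarrow> (nat \<Rightarrow> sign) set" where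
  "sign_vectors m = {1..m} \<rightarrow>\<^sub>E UNIV"

text \<open>
  \<open>P \<sigma>\<close> for \<open>\<sigma> \<in> sign_vectors m\<close> is the family of distributions, \<open>\<mu>\<close> the common first
  marginal, \<open>\<X> 0, ..., \<X> m\<close> the partition (whose blocks may be empty), and \<open>p Minus\<close> and
  \<open>p Plus\<close> are the two conditional probabilities of \<open>h1\<close>.
\<close>

definition hypercube ::
  "'x measure \<Rightarrow> 'y measure \<Rightarrow> nat \<Rightarrow> ((nat \<Rightarrow> sign) \<Rightarrow> ('x \<times> 'y) measure) \<Rightarrow> 'x measure \<Rightarrow>
   (nat \<Rightarrow> 'x set) \<Rightarrow> 'y \<Rightarrow> 'y \<Rightarrow> (sign \<Rightarrow> real) \<Rightarrow> bool" where
  "hypercube M N m P \<mu> \<X> h1 h2 p \<longleftrightarrow>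
     1 \<le> m \<and>
     (\<forall>\<sigma> \<in> sign_vectors m. P \<sigma> \<in> space (prob_algebra (M \<Otimes>\<^sub>M N)) \<and> distr (P \<sigma>) M fst = \<mu>) \<and>
     (\<forall>j\<le>m. \<X> j \<in> sets M) \<and> disjoint_family_on \<X> {..m} \<and> (\<Union>j\<le>m. \<X> j) = space M \<and>
     (\<forall>j\<in>{1..m}. measure \<mu> (\<X> j) = measure \<mu> (\<X> 1)) \<and>
     h1 \<in> space N \<and> h2 \<in> space N \<and> h1 \<noteq> h2 \<and> {h1} \<in> sets N \<and> {h2} \<in> sets N \<and>
     0 \<le> p Minus \<and> p Minus < p Plus \<and> p Plus \<le> 1 \<and>
     (\<exists>\<kappa>. (\<forall>\<sigma> \<in> sign_vectors m. is_cond_distr M N (P \<sigma>) (\<kappa> \<sigma>)) \<and>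
          (\<forall>\<sigma> \<in> sign_vectors m. \<forall>j\<in>{1..m}. \<forall>x \<in> \<X> j.
             measure (\<kappa> \<sigma> x) {h1} = p (\<sigma> j) \<and> p (\<sigma> j) = 1 - measure (\<kappa> \<sigma> x) {h2}) \<and>
          (\<forall>\<sigma> \<in> sign_vectors m. \<forall>\<tau> \<in> sign_vectors m. \<forall>x \<in> \<X> 0. \<kappa> \<sigma> x = \<kappa> \<tau> x))"

definition edge_probability :: "'x measure \<Rightarrow> (nat \<Rightarrow> 'x set) \<Rightarrow> real" where
  "edge_probability \<mu> \<X> = measure \<mu> (\<X> 1)"

definition varphi :: "('y \<Rightarrow> 'y \<Rightarrow> real) \<Rightarrow> 'y \<Rightarrow> 'y \<Rightarrow> real \<Rightarrow> 'y \<Rightarrow> real" where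
  "varphi loss h1 h2 q y = q * loss h1 y + (1 - q) * loss h2 y"

text \<open>
  If a family of distributions with well-defined excess risks contains a hypercube with positive
  edge probability, then this infimum is finite for all \<open>q\<close> between \<open>p Minus\<close> and \<open>p Plus\<close>, and
  the characteristic function uses no other \<open>q\<close>. If the edge probability is zero, the
  characteristic function vanishes whatever the values of \<open>phi\<close>.
\<close>

definition phi :: "'y measure \<Rightarrow> ('y \<Rightarrow> 'y \<Rightarrow> real) \<Rightarrow> 'y \<Rightarrow> 'y \<Rightarrow> real \<Rightarrow> real" where
  "phi N loss h1 h2 q = (INF y \<in> space N. varphi loss h1 h2 q y)"

definition psi ::
  "'y measure \<Rightarrow> ('y \<Rightarrow> 'y \<Rightarrow> real) \<Rightarrow> 'y \<Rightarrow> 'y \<Rightarrow> real \<Rightarrow> real \<Rightarrow> real \<Rightarrow> real" where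
  "psi N loss h1 h2 qp qm a =
     phi N loss h1 h2 (a * qp + (1 - a) * qm)
       - a * phi N loss h1 h2 qp - (1 - a) * phi N loss h1 h2 qm"

text \<open>Relevant for \<open>u \<ge> 0\<close> only.\<close>

definition characteristic_function ::
  "'y measure \<Rightarrow> ('y \<Rightarrow> 'y \<Rightarrow> real) \<Rightarrow> nat \<Rightarrow> real \<Rightarrow> 'y \<Rightarrow> 'y \<Rightarrow> (sign \<Rightarrow> real) \<Rightarrow> real \<Rightarrow> real" where
  "characteristic_function N loss m w h1 h2 p u =
     real m * w / 2 * (u + 1) * psi N loss h1 h2 (p Plus) (p Minus) (u / (u + 1))"

definition is_base ::
  "'x measure \<Rightarrow> 'y measure \<Rightarrow> 'x measure \<Rightarrow> (nat \<Rightarrow> 'x set) \<Rightarrow> 'y \<Rightarrow> 'y \<Rightarrow> ('x \<times> 'y) measure \<Rightarrow> bool"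
  where
  "is_base M N \<mu> \<X> h1 h2 P0 \<longleftrightarrow>
     P0 \<in> space (prob_algebra (M \<Otimes>\<^sub>M N)) \<and> distr P0 M fst = \<mu> \<and>
     (\<exists>\<kappa>. is_cond_distr M N P0 \<kappa> \<and>
          (\<forall>x \<in> space M - \<X> 0. measure (\<kappa> x) {h1} = 1 / 2 \<and> measure (\<kappa> x) {h2} = 1 / 2))"

definition representative ::
  "(nat \<Rightarrow> 'x set) \<Rightarrow> 'y \<Rightarrow> 'y \<Rightarrow> (sign \<Rightarrow> real) \<Rightarrow> ('x \<times> 'y) measure \<Rightarrow> sign \<Rightarrow> ('x \<times> 'y) measure"
  where
  "representative \<X> h1 h2 p P0 s =
     density P0 (\<lambda>(x, y). ennreal
       (if x \<in> \<X> 1 \<and> y = h1 then 2 * p s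
        else if x \<in> \<X> 1 \<and> y = h2 then 2 * (1 - p s)
        else 1))"

definition similarity :: "(real \<Rightarrow> real) \<Rightarrow> 'a measure \<Rightarrow> 'a measure \<Rightarrow> real" where
  "similarity f P Q =
     (if absolutely_continuous Q P then (\<integral>x. f (enn2real (RN_deriv Q P x)) \<partial>Q) else f 0)"

end

theory Submission imports Defs begin

text \<open>
  Write \<open>\<phi>\<^sub>p\<close> for \<open>varphi\<close> at \<open>p\<close>. Pointwise comparison of \<open>g\<close> with a prediction that agrees with \<open>g\<close>
  on \<open>\<X> 0\<close> and is a near-minimiser of \<open>\<phi>\<^sub>p\<close>, \<open>p = p (\<sigma> j)\<close>, on \<open>\<X> j\<close> bounds the excess risk of \<open>g\<close>
  under \<open>P \<sigma>\<close> from below by the sum over \<open>j\<close> of the integrals of \<open>\<phi>\<^sub>p (g x) - phi p\<close> over \<open>\<X> j\<close>. Averaging over \<open>\<sigma>\<close> and pairing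
  every \<open>\<sigma>\<close> with its flip at \<open>j\<close> leaves a test between two product measures whose density ratio
  \<open>u\<close> satisfies, for every prediction \<open>y\<close>,
  \<open>u (\<phi>\<^sub>+ y - phi p\<^sub>+) + (\<phi>\<^sub>- y - phi p\<^sub>-) \<ge> (u + 1) psi (u / (u + 1))\<close>
  by definition of the infimum at the mixed probability. The law of \<open>u\<close> depends only on the
  edge probability and on \<open>p\<close>, so the representatives have the same ratio law.
\<close>

subsection \<open>Densities, kernels and extended expectations\<close>

text \<open>Rectangles determine a finite product of probability measures. On a rectangle the weight
  and the indicator both factor over the coordinates, so the integral splits into one-dimensional
  ones.\<close>

lemma PiM_density:
  assumes I: "finite I" and P: "prob_space P" "prob_space (density P f)"
    and f[measurable]: "f \<in> borel_measurable P"
  shows "(\<Pi>\<^sub>M i\<in>I. density P f) = density (\<Pi>\<^sub>M i\<in>I. P) (\<lambda>z. \<Prod>i\<in>I. f (z i))"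
proof -
  interpret D: product_prob_space "\<lambda>_. density P f" I
    using P(2) by (simp add: product_prob_space_def product_prob_space_axioms_def product_sigma_finite_def prob_space_imp_sigma_finite)
  interpret P: product_prob_space "\<lambda>_. P" I
    using P(1) by (simp add: product_prob_space_def product_prob_space_axioms_def product_sigma_finite_def prob_space_imp_sigma_finite)
  have sets_eq: "sets (\<Pi>\<^sub>M i\<in>I. P) = sets (\<Pi>\<^sub>M i\<in>I. density P f)"
    by (intro sets_PiM_cong) auto
  show ?thesis
  proof (rule D.PiM_eqI[OF I, symmetric])
    show "sets (density (\<Pi>\<^sub>M i\<in>I. P) (\<lambda>z. \<Prod>i\<in>I. f (z i))) = sets (\<Pi>\<^sub>M i\<in>I. density P f)"
      by (simp add: sets_eq)
    fix A assume A: "\<And>i. i \<in> I \<Longrightarrow> A i \<in> sets (density P f)"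
    then have A'[measurable]: "i \<in> I \<Longrightarrow> A i \<in> sets P" for i by simp
    have "emeasure (density (\<Pi>\<^sub>M i\<in>I. P) (\<lambda>z. \<Prod>i\<in>I. f (z i))) (Pi\<^sub>E I A)
        = (\<integral>\<^sup>+z. (\<Prod>i\<in>I. f (z i)) * indicator (Pi\<^sub>E I A) z \<partial>(\<Pi>\<^sub>M i\<in>I. P))"
      using I by (intro emeasure_density sets_PiM_I_finite) auto
    also have "\<dots> = (\<integral>\<^sup>+z. (\<Prod>i\<in>I. f (z i) * indicator (A i) (z i)) \<partial>(\<Pi>\<^sub>M i\<in>I. P))"
    proof (intro nn_integral_cong)
      fix z assume z: "z \<in> space (\<Pi>\<^sub>M i\<in>I. P)"
      have "(indicator (Pi\<^sub>E I A) z :: ennreal) = (\<Prod>i\<in>I. indicator (A i) (z i))"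
      proof (cases "z \<in> Pi\<^sub>E I A")
        case True
        then show ?thesis by (auto simp: PiE_iff intro!: prod.neutral[symmetric])
      next
        case False
        with z obtain i where "i \<in> I" "z i \<notin> A i"
          by (auto simp: space_PiM PiE_iff)
        then have "(\<Prod>i\<in>I. indicator (A i) (z i) :: ennreal) = 0"
          using I by (intro prod_zero bexI[of _ i]) auto
        with False show ?thesis by simp
      qed
      then show "(\<Prod>i\<in>I. f (z i)) * indicator (Pi\<^sub>E I A) z = (\<Prod>i\<in>I. f (z i) * indicator (A i) (z i))"
        by (simp add: prod.distrib)
    qed
    also have "\<dots> = (\<Prod>i\<in>I. \<integral>\<^sup>+x. f x * indicator (A i) x \<partial>P)"
      using I by (intro P.product_nn_integral_prod) auto
    also have "\<dots> = (\<Prod>i\<in>I. emeasure (density P f) (A i))"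
      by (intro prod.cong refl emeasure_density[symmetric]) auto
    finally show "emeasure (density (\<Pi>\<^sub>M i\<in>I. P) (\<lambda>z. \<Prod>i\<in>I. f (z i))) (Pi\<^sub>E I A)
      = (\<Prod>i\<in>I. emeasure (density P f) (A i))" .
  qed
qed

text \<open>The values \<open>r (z i)\<close> are independent with the law of \<open>r\<close>, so
  the integral sees \<open>P\<close> only through \<open>distr P borel r\<close>. Product measures
  over different spaces thus give the same value as soon as these laws agree.\<close>

lemma nn_integral_PiM_prod_distr:
  fixes F :: "real \<Rightarrow> ennreal"
  assumes I: "finite I" and P: "prob_space P" 
    and r[measurable]: "r \<in> borel_measurable P" and F[measurable]: "F \<in> borel_measurable borel"
  shows "(\<integral>\<^sup>+z. F (\<Prod>i\<in>I. r (z i)) \<partial>(\<Pi>\<^sub>M i\<in>I. P))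
    = (\<integral>\<^sup>+u. F (\<Prod>i\<in>I. u i) \<partial>(\<Pi>\<^sub>M i\<in>I. distr P borel r))"
proof -
  have D: "prob_space (distr P borel r)"
    by (rule prob_space.prob_space_distr[OF P r])
  have "distr P (distr P borel r) r = distr P borel r"
    by (rule distr_cong) auto
  then have eq: "distr (\<Pi>\<^sub>M i\<in>I. P) (\<Pi>\<^sub>M i\<in>I. distr P borel r) (compose I r) = (\<Pi>\<^sub>M i\<in>I. distr P borel r)"
    using distr_PiM_finite_prob_space'[OF I, of "\<lambda>_. P" "\<lambda>_. distr P borel r" r] P D by simp
  have [measurable]: "compose I r \<in> (\<Pi>\<^sub>M i\<in>I. P) \<rightarrow>\<^sub>M (\<Pi>\<^sub>M i\<in>I. distr P borel r)"
    unfolding compose_def by measurable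
  show ?thesis
    by (subst eq[symmetric], subst nn_integral_distr) (auto simp: compose_def cong: prod.cong)
qed

text \<open>Disintegration: \<open>K x\<close> is the law of \<open>(x, Y)\<close> for
  \<open>Y\<close> drawn from \<open>\<kappa> x\<close>. Then \<open>P\<close> and the mixture of
  \<open>K\<close> over the marginal agree on rectangles, an intersection-stable generator, hence
  are equal.\<close>

lemma nn_integral_cond_distr:
  assumes P: "P \<in> space (prob_algebra (M \<Otimes>\<^sub>M N))" and \<kappa>: "is_cond_distr M N P \<kappa>"
    and f[measurable]: "f \<in> borel_measurable (M \<Otimes>\<^sub>M N)"
  shows "(\<integral>\<^sup>+z. f z \<partial>P) = (\<integral>\<^sup>+x. \<integral>\<^sup>+y. f (x, y) \<partial>\<kappa> x \<partial>distr P M fst)"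
proof -
  let ?\<mu> = "distr P M fst"
  have sP[simp, measurable_cong]: "sets P = sets (M \<Otimes>\<^sub>M N)" and "prob_space P"
    using P by (auto simp: space_prob_algebra)
  then interpret P: prob_space P by simp
  have \<kappa>M: "\<kappa> \<in> M \<rightarrow>\<^sub>M prob_algebra N" using \<kappa> by (simp add: is_cond_distr_def)
  then have \<kappa>s[measurable]: "\<kappa> \<in> M \<rightarrow>\<^sub>M subprob_algebra N" by (rule measurable_prob_algebraD)
  have sk: "sets (\<kappa> x) = sets N" if "x \<in> space M" for x
    using measurable_space[OF \<kappa>M that] by (simp add: space_prob_algebra)
  define K where "K x = distr (\<kappa> x) (M \<Otimes>\<^sub>M N) (Pair x)" for x
  have K[measurable]: "K \<in> ?\<mu> \<rightarrow>\<^sub>M subprob_algebra (M \<Otimes>\<^sub>M N)"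
    unfolding K_def
    by (rule measurable_distr2[where M=N and L="?\<mu>"]) (auto simp: split_beta')
  \<comment> \<open>\<open>bind\<close> mixes the kernels only over a nonempty space;
    \<open>P\<close> is a probability, so its space is not empty.\<close>
  have ne: "space ?\<mu> \<noteq> {}" using P.not_empty sets_eq_imp_space_eq[OF sP] by (auto simp: space_pair_measure)
  have eq: "P = ?\<mu> \<bind> K"
  proof (rule measure_eqI_generator_eq[OF Int_stable_pair_measure_generator[of M N] pair_measure_closed[of M N], where A="\<lambda>_. space M \<times> space N"])
    show "sets P = sigma_sets (space M \<times> space N) {a \<times> b |a b. a \<in> sets M \<and> b \<in> sets N}"
      by (simp add: sets_pair_measure)
    show "sets (?\<mu> \<bind> K) = sigma_sets (space M \<times> space N) {a \<times> b |a b. a \<in> sets M \<and> b \<in> sets N}"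
      by (subst sets_bind[OF sets_kernel[OF K]]) (use ne in \<open>auto simp: sets_pair_measure\<close>)
    fix X assume "X \<in> {a \<times> b |a b. a \<in> sets M \<and> b \<in> sets N}"
    then obtain a b where X: "X = a \<times> b" and [measurable]: "a \<in> sets M" "b \<in> sets N" by auto
    have "emeasure (?\<mu> \<bind> K) X = (\<integral>\<^sup>+x. emeasure (K x) X \<partial>?\<mu>)"
      unfolding X by (rule emeasure_bind[OF ne K]) simp
    also have "\<dots> = (\<integral>\<^sup>+x\<in>a. emeasure (\<kappa> x) b \<partial>?\<mu>)"
    proof (rule nn_integral_cong)
      fix x assume "x \<in> space ?\<mu>"
      then have x: "x \<in> space M" by simp
      have "emeasure (K x) X = emeasure (\<kappa> x) (Pair x -` X \<inter> space (\<kappa> x))"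
        unfolding K_def using x sk[OF x] unfolding X
        by (intro emeasure_distr) (auto simp: cong: measurable_cong_sets)
      also have "Pair x -` X \<inter> space (\<kappa> x) = (if x \<in> a then b else {})"
        unfolding X sets_eq_imp_space_eq[OF sk[OF x]] using sets.sets_into_space[of b N] by auto
      finally show "emeasure (K x) X = emeasure (\<kappa> x) b * indicator a x" by simp
    qed
    also have "\<dots> = emeasure P X" using \<kappa> unfolding X by (simp add: is_cond_distr_def)
    finally show "emeasure P X = emeasure (?\<mu> \<bind> K) X" by simp
  qed (auto)
  have "(\<integral>\<^sup>+z. f z \<partial>P) = (\<integral>\<^sup>+x. \<integral>\<^sup>+z. f z \<partial>K x \<partial>?\<mu>)"
    by (subst eq) (rule nn_integral_bind[OF f K])
  also have "\<dots> = (\<integral>\<^sup>+x. \<integral>\<^sup>+y. f (x, y) \<partial>\<kappa> x \<partial>?\<mu>)"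
    unfolding K_def
    by (intro nn_integral_cong, subst nn_integral_distr) (auto simp: sk cong: measurable_cong_sets)
  finally show ?thesis .
qed

text \<open>The two masses add up to one, so \<open>K\<close> almost surely takes one of the two
  values.\<close>

lemma nn_integral_two_point:
  assumes K: "prob_space K" "sets K = sets N"
    and h: "{h1} \<in> sets N" "{h2} \<in> sets N" "h1 \<noteq> h2"
    and q: "measure K {h1} = q" "measure K {h2} = 1 - q"
    and f[measurable]: "f \<in> borel_measurable N"
  shows "(\<integral>\<^sup>+y. f y \<partial>K) = ennreal q * f h1 + ennreal (1 - q) * f h2"
proof -
  interpret prob_space K by fact
  have [measurable_cong]: "sets K = sets N" by fact
  have [measurable]: "{h1} \<in> sets K" "{h2} \<in> sets K" using h K by auto
  have "measure K ({h1} \<union> {h2}) = 1"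
    using h q by (subst finite_measure_Union) auto
  moreover have "{h1} \<union> {h2} \<in> sets K" by (intro sets.Un) measurable
  ultimately have "AE y in K. y \<in> {h1} \<union> {h2}"
    using prob_eq_1 by blast
  then have "(\<integral>\<^sup>+y. f y \<partial>K) = (\<integral>\<^sup>+y. f h1 * indicator {h1} y + f h2 * indicator {h2} y \<partial>K)"
    by (intro nn_integral_cong_AE) (auto elim!: eventually_mono simp: indicator_def h(3) h(3)[symmetric])
  also have "\<dots> = f h1 * emeasure K {h1} + f h2 * emeasure K {h2}"
    by (subst nn_integral_add) (auto simp: nn_integral_cmult_indicator)
  finally show ?thesis by (simp add: emeasure_eq_measure q mult.commute)
qed

section \<open>Extended real inequalities through positive and negative parts\<close>

text \<open>\<open>ennreal t\<close> and \<open>ennreal (- t)\<close> are the parts of the real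
  \<open>t\<close>, so the premise is the conclusion with every subtracted term moved across.
  Finiteness of \<open>B\<close> makes moving it back legitimate, also when \<open>A\<close> is
  infinite.\<close>

lemma ennreal_diff_le_imp_ereal:
  assumes "B \<noteq> \<infinity>" "ennreal t + D + B \<le> A + ennreal (- t)"
  shows "ereal t + enn2ereal D \<le> enn2ereal A - enn2ereal B"
proof (cases A)
  case (real a)
  obtain b where b: "B = ennreal b" "b \<ge> 0" using assms by (cases B) auto
  obtain d where d: "D = ennreal d" "d \<ge> 0"
    using assms real by (cases D) (auto simp: top_unique ennreal_plus[symmetric] simp del: ennreal_plus)
  show ?thesis
  proof (cases "t \<ge> 0")
    case True
    then have "ennreal (t + d + b) \<le> ennreal a" using assms real b d by (simp add: ennreal_neg)
    then have "t + d + b \<le> a" using real by (simp add: ennreal_le_iff)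
    then show ?thesis using real b d by (simp add: enn2ereal_ennreal)
  next
    case False
    then have "ennreal (d + b) \<le> ennreal (a - t)" using assms real b d by (simp add: ennreal_neg ennreal_plus[symmetric] del: ennreal_plus)
    then have "d + b \<le> a - t" using real False by (simp add: ennreal_le_iff)
    then show ?thesis using real b d by (simp add: enn2ereal_ennreal)
  qed
next
  case top
  then show ?thesis using assms by (cases B) (auto simp: enn2ereal_ennreal)
qed

text \<open>Turns a pointwise bound into a form that can be integrated term by term; the second
  claim dominates the negative part of \<open>R\<close> by a constant.\<close>

lemma ereal_le_imp_e2ennreal_parts:
  assumes "ereal t + enn2ereal D \<le> R"
  shows "ennreal t + D + e2ennreal (- R) \<le> e2ennreal R + ennreal (- t)" "e2ennreal (- R) \<le> ennreal (- t)"
proof -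
  show "e2ennreal (- R) \<le> ennreal (- t)"
  proof -
    have "ereal t \<le> R" using assms
      by (meson add_increasing2 ereal_le_add_self enn2ereal_nonneg order_trans)
    then have "- R \<le> ereal (- t)" by (metis ereal_minus_le_minus uminus_ereal.simps(1))
    then show ?thesis by (metis e2ennreal_ereal e2ennreal_mono)
  qed
  show "ennreal t + D + e2ennreal (- R) \<le> e2ennreal R + ennreal (- t)"
  proof (cases R)
    case (real r)
    obtain d where d: "D = ennreal d" "d \<ge> 0"
      using assms real by (cases D) auto
    have *: "t + d \<le> r" using assms real d by (simp add: enn2ereal_ennreal)
    show ?thesis unfolding real d(1) uminus_ereal.simps e2ennreal_ereal
    proof (cases "t \<ge> 0"; cases "r \<ge> 0")
      show "ennreal t + ennreal d + ennreal (- r) \<le> ennreal r + ennreal (- t)" if "\<not> 0 \<le> t" "0 \<le> r"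
        using that * d by (simp add: ennreal_neg ennreal_plus[symmetric] ennreal_leI del: ennreal_plus)
      show "ennreal t + ennreal d + ennreal (- r) \<le> ennreal r + ennreal (- t)" if "\<not> 0 \<le> t" "\<not> 0 \<le> r"
        using that * d by (simp add: ennreal_neg ennreal_plus[symmetric] ennreal_leI del: ennreal_plus)
      show "ennreal t + ennreal d + ennreal (- r) \<le> ennreal r + ennreal (- t)" if "0 \<le> t" "0 \<le> r"
        using that * d by (simp add: ennreal_neg ennreal_plus[symmetric] ennreal_leI del: ennreal_plus)
      show "ennreal t + ennreal d + ennreal (- r) \<le> ennreal r + ennreal (- t)" if "0 \<le> t" "\<not> 0 \<le> r"
        using that * d by linarith
    qed
  qed (use assms in auto)
qed

text \<open>The negative part of \<open>R\<close> is at most \<open>ennreal (- t)\<close>, hence has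
  a finite integral under a probability, and the expectation is not a difference of infinities. The
  subtraction-free inequality is integrated and then reassembled.\<close>

lemma ereal_expectation_ge:
  assumes T: "prob_space T" and R[measurable]: "R \<in> borel_measurable T"
    and D[measurable]: "D \<in> borel_measurable T"
    and le: "\<And>z. z \<in> space T \<Longrightarrow> ereal t + enn2ereal (D z) \<le> R z"
  shows "ereal t + enn2ereal (\<integral>\<^sup>+z. D z \<partial>T) \<le> ereal_expectation T R"
proof -
  interpret prob_space T by fact
  have "(\<integral>\<^sup>+z. e2ennreal (- R z) \<partial>T) \<le> (\<integral>\<^sup>+z. ennreal (- t) \<partial>T)"
    by (intro nn_integral_mono ereal_le_imp_e2ennreal_parts(2)[OF le])
  then have fin: "(\<integral>\<^sup>+z. e2ennreal (- R z) \<partial>T) \<noteq> \<infinity>"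
    by (auto simp: emeasure_space_1 top_unique)
  have "(\<integral>\<^sup>+z. ennreal t + D z + e2ennreal (- R z) \<partial>T) \<le> (\<integral>\<^sup>+z. e2ennreal (R z) + ennreal (- t) \<partial>T)"
    by (intro nn_integral_mono ereal_le_imp_e2ennreal_parts(1)[OF le])
  then have "ennreal t + (\<integral>\<^sup>+z. D z \<partial>T) + (\<integral>\<^sup>+z. e2ennreal (- R z) \<partial>T) \<le> (\<integral>\<^sup>+z. e2ennreal (R z) \<partial>T) + ennreal (- t)"
    by (simp add: nn_integral_add emeasure_space_1)
  from ennreal_diff_le_imp_ereal[OF fin this] show ?thesis
    unfolding ereal_expectation_def .
qed

lemma risk_eq:
  "risk loss Q g = enn2ereal (\<integral>\<^sup>+(x, y). ennreal (loss y (g x)) \<partial>Q)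
     - enn2ereal (\<integral>\<^sup>+(x, y). ennreal (- loss y (g x)) \<partial>Q)"
  by (simp add: risk_def ereal_expectation_def split_beta')

text \<open>\<open>ennreal\<close> truncates at 0, so \<open>a\<close> and \<open>b\<close> are the
  integrals of the positive and negative parts of a two-valued variable; both are finite, and their
  difference is its mean.\<close>

lemma two_point_parts:
  fixes q l1 l2 :: real
  assumes "0 \<le> q" "q \<le> 1"
  obtains a b where "ennreal q * ennreal l1 + ennreal (1 - q) * ennreal l2 = ennreal a"
    "ennreal q * ennreal (- l1) + ennreal (1 - q) * ennreal (- l2) = ennreal b"
    "0 \<le> a" "0 \<le> b" "a - b = q * l1 + (1 - q) * l2"
proof
  have max0: "ennreal l = ennreal (max 0 l)" for l by (simp add: max_def ennreal_neg)
  have *: "ennreal q * ennreal u + ennreal (1 - q) * ennreal v = ennreal (q * max 0 u + (1 - q) * max 0 v)" for u v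
    unfolding max0[of u] max0[of v] using assms by (subst ennreal_plus) (auto simp: ennreal_mult)
  show "ennreal q * ennreal l1 + ennreal (1 - q) * ennreal l2 = ennreal (q * max 0 l1 + (1 - q) * max 0 l2)"
    "ennreal q * ennreal (- l1) + ennreal (1 - q) * ennreal (- l2) = ennreal (q * max 0 (- l1) + (1 - q) * max 0 (- l2))"
    by (fact *)+
  show "0 \<le> q * max 0 l1 + (1 - q) * max 0 l2" "0 \<le> q * max 0 (- l1) + (1 - q) * max 0 (- l2)"
    using assms by auto
  have diff: "q * u + (1 - q) * v - (q * u' + (1 - q) * v') = q * l1 + (1 - q) * l2"
    if "u - u' = l1" "v - v' = l2" for u u' v v'
    unfolding that[symmetric] by (simp add: algebra_simps)
  show "q * max 0 l1 + (1 - q) * max 0 l2 - (q * max 0 (- l1) + (1 - q) * max 0 (- l2)) = q * l1 + (1 - q) * l2"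
    by (rule diff) (simp_all add: max_def)
qed

lemma training_distr_sets:
  "sets P = sets Q \<Longrightarrow> sets (training_distr n P) = sets (\<Pi>\<^sub>M i\<in>{1..n}. Q)"
  unfolding training_distr_def by (rule sets_PiM_cong) auto

lemma prob_space_training_distr: "prob_space P \<Longrightarrow> prob_space (training_distr n P)"
  unfolding training_distr_def by (rule prob_space_PiM)

text \<open>For integrable \<open>f\<close> the negative part is dropped; otherwise the integral is
  0 by default. This moves the similarity into nonnegative integrals without an integrability
  argument for the characteristic function.\<close>

lemma integral_le_nn_integral:
  fixes f :: "'a \<Rightarrow> real"
  shows "ennreal (integral\<^sup>L Q f) \<le> (\<integral>\<^sup>+x. ennreal (f x) \<partial>Q)"
proof (cases "integrable Q f")
  case True
  then have fin: "(\<integral>\<^sup>+x. ennreal (f x) \<partial>Q) < top"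
    using real_integrable_def[of Q f] by (simp add: less_top)
  have "integral\<^sup>L Q f \<le> enn2real (\<integral>\<^sup>+x. ennreal (f x) \<partial>Q)"
    unfolding real_lebesgue_integral_def[OF True] by simp
  then have "ennreal (integral\<^sup>L Q f) \<le> ennreal (enn2real (\<integral>\<^sup>+x. ennreal (f x) \<partial>Q))"
    by (rule ennreal_leI)
  then show ?thesis using fin by simp
qed (simp add: not_integrable_integral_eq)

lemma (in prob_space) nn_integral_if_const:
  assumes "A \<in> sets M"
  shows "(\<integral>\<^sup>+x. (if x \<in> A then C else C') \<partial>M) = C * emeasure M A + C' * emeasure M (space M - A)"
proof -
  have "(\<integral>\<^sup>+x. (if x \<in> A then C else C') \<partial>M)
    = (\<integral>\<^sup>+x. C * indicator A x + C' * indicator (space M - A) x \<partial>M)"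
    by (intro nn_integral_cong) (auto simp: indicator_def)
  also have "\<dots> = C * emeasure M A + C' * emeasure M (space M - A)"
    using assms by (subst nn_integral_add) (auto simp: nn_integral_cmult_indicator)
  finally show ?thesis .
qed

subsection \<open>Excess risk on a hypercube\<close>

locale assouad_hypercube =
  fixes M :: "'x measure" and N :: "'y measure"
    and loss :: "'y \<Rightarrow> 'y \<Rightarrow> real" and m :: nat
    and P :: "(nat \<Rightarrow> sign) \<Rightarrow> ('x \<times> 'y) measure"
    and \<mu> :: "'x measure" and X :: "nat \<Rightarrow> 'x set" and h1 h2 :: 'y and p :: "sign \<Rightarrow> real"
    and \<kappa> :: "(nat \<Rightarrow> sign) \<Rightarrow> 'x \<Rightarrow> 'y measure"
  assumes loss: "(\<lambda>(y, y'). loss y y') \<in> borel_measurable (N \<Otimes>\<^sub>M N)"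
    and well_defined: "\<sigma> \<in> sign_vectors m \<Longrightarrow> excess_risk_well_defined M N loss (P \<sigma>)"
    and m: "1 \<le> m"
    and P: "\<sigma> \<in> sign_vectors m \<Longrightarrow> P \<sigma> \<in> space (prob_algebra (M \<Otimes>\<^sub>M N))"
    and marginal: "\<sigma> \<in> sign_vectors m \<Longrightarrow> distr (P \<sigma>) M fst = \<mu>"
    and X_sets: "j \<le> m \<Longrightarrow> X j \<in> sets M"
    and X_disjoint: "disjoint_family_on X {..m}"
    and X_cover: "(\<Union>j\<le>m. X j) = space M"
    and X_measure: "j \<in> {1..m} \<Longrightarrow> measure \<mu> (X j) = measure \<mu> (X 1)"
    and h_space: "h1 \<in> space N" "h2 \<in> space N" and h_neq: "h1 \<noteq> h2"
    and h_sets[measurable]: "{h1} \<in> sets N" "{h2} \<in> sets N"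
    and p: "0 \<le> p Minus" "p Minus < p Plus" "p Plus \<le> 1"
    and cond: "\<sigma> \<in> sign_vectors m \<Longrightarrow> is_cond_distr M N (P \<sigma>) (\<kappa> \<sigma>)"
    and cond_edge: "\<sigma> \<in> sign_vectors m \<Longrightarrow> j \<in> {1..m} \<Longrightarrow> x \<in> X j \<Longrightarrow>
      measure (\<kappa> \<sigma> x) {h1} = p (\<sigma> j) \<and> p (\<sigma> j) = 1 - measure (\<kappa> \<sigma> x) {h2}"
    and cond_0: "\<sigma> \<in> sign_vectors m \<Longrightarrow> \<tau> \<in> sign_vectors m \<Longrightarrow> x \<in> X 0 \<Longrightarrow> \<kappa> \<sigma> x = \<kappa> \<tau> x"
begin

declare One_nat_def[simp del]

abbreviation w :: real where "w \<equiv> measure \<mu> (X 1)"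
abbreviation \<phi> :: "real \<Rightarrow> real" where "\<phi> \<equiv> phi N loss h1 h2"
abbreviation \<phi>y :: "real \<Rightarrow> 'y \<Rightarrow> real" where "\<phi>y \<equiv> varphi loss h1 h2"

lemma loss_measurable[measurable (raw)]:
  assumes f: "f \<in> A \<rightarrow>\<^sub>M N" and g: "g \<in> A \<rightarrow>\<^sub>M N"
  shows "(\<lambda>x. loss (f x) (g x)) \<in> borel_measurable A"
  using measurable_compose[OF measurable_Pair[OF f g] loss] by simp

lemma varphi_measurable[measurable (raw)]:
  assumes [measurable]: "g \<in> A \<rightarrow>\<^sub>M N"
  shows "(\<lambda>x. \<phi>y q (g x)) \<in> borel_measurable A"
  using h_space unfolding varphi_def by measurable

lemma p01: "0 \<le> p s" "p s \<le> 1"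
  using p by (cases s; simp)+

section \<open>Sign vectors, blocks of the partition, and kernels\<close>

lemma const_sign_vector: "(\<lambda>j\<in>{1..m}. s) \<in> sign_vectors m"
  by (simp add: sign_vectors_def)

lemma sign_vectors_upd: "\<sigma> \<in> sign_vectors m \<Longrightarrow> j \<in> {1..m} \<Longrightarrow> \<sigma>(j := s) \<in> sign_vectors m"
  by (auto simp: sign_vectors_def PiE_iff extensional_def)

lemma sets_P[simp]: "\<sigma> \<in> sign_vectors m \<Longrightarrow> sets (P \<sigma>) = sets (M \<Otimes>\<^sub>M N)"
  using P[of \<sigma>] by (simp add: space_prob_algebra)

lemma prob_space_P: "\<sigma> \<in> sign_vectors m \<Longrightarrow> prob_space (P \<sigma>)"
  using P[of \<sigma>] by (simp add: space_prob_algebra)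

lemma sets_\<mu>[simp, measurable_cong]: "sets \<mu> = sets M"
  using marginal[OF const_sign_vector] by (metis sets_distr)

lemma space_\<mu>[simp]: "space \<mu> = space M"
  by (rule sets_eq_imp_space_eq) simp

sublocale \<mu>: prob_space \<mu>
proof -
  let ?s = "\<lambda>j\<in>{1..m}. Plus"
  have [measurable_cong]: "sets (P ?s) = sets (M \<Otimes>\<^sub>M N)"
    by (rule sets_P[OF const_sign_vector])
  have "prob_space (distr (P ?s) M fst)"
    by (rule prob_space.prob_space_distr[OF prob_space_P[OF const_sign_vector]]) measurable
  then show "prob_space \<mu>"
    by (simp only: marginal[OF const_sign_vector])
qed

lemma blockE:
  assumes "x \<in> space M"
  obtains "x \<in> X 0" | j where "j \<in> {1..m}" "x \<in> X j"
proof -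
  obtain j where "j \<le> m" "x \<in> X j" using assms X_cover by blast
  then show ?thesis using that by (cases "j = 0") (auto simp: Suc_le_eq One_nat_def)
qed

lemma block_unique: "x \<in> X i \<Longrightarrow> x \<in> X j \<Longrightarrow> i \<le> m \<Longrightarrow> j \<le> m \<Longrightarrow> i = j"
  using X_disjoint by (auto simp: disjoint_family_on_def)

lemma block_notin: "x \<in> X i \<Longrightarrow> i \<le> m \<Longrightarrow> j \<le> m \<Longrightarrow> i \<noteq> j \<Longrightarrow> x \<notin> X j"
  using block_unique by blast

lemma X_subset: "j \<le> m \<Longrightarrow> X j \<subseteq> space M"
  using X_cover by blast

lemma emeasure_edge: "j \<in> {1..m} \<Longrightarrow> emeasure \<mu> (X j) = ennreal w"
  using X_measure[of j] by (simp add: \<mu>.emeasure_eq_measure)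

lemma nn_integral_P:
  assumes "\<sigma> \<in> sign_vectors m" "f \<in> borel_measurable (M \<Otimes>\<^sub>M N)"
  shows "(\<integral>\<^sup>+z. f z \<partial>P \<sigma>) = (\<integral>\<^sup>+x. \<integral>\<^sup>+y. f (x, y) \<partial>\<kappa> \<sigma> x \<partial>\<mu>)"
  using nn_integral_cond_distr[OF P cond, of \<sigma> f] assms marginal by simp

lemma kernel_measurable: "\<sigma> \<in> sign_vectors m \<Longrightarrow> \<kappa> \<sigma> \<in> M \<rightarrow>\<^sub>M prob_algebra N"
  using cond by (simp add: is_cond_distr_def)

lemma kernel:
  assumes "\<sigma> \<in> sign_vectors m" "x \<in> space M"
  shows "prob_space (\<kappa> \<sigma> x)" "sets (\<kappa> \<sigma> x) = sets N"
  using measurable_space[OF kernel_measurable assms(2)] assms by (auto simp: space_prob_algebra)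

lemma nn_integral_kernel_edge:
  assumes "\<sigma> \<in> sign_vectors m" "j \<in> {1..m}" "x \<in> X j" "f \<in> borel_measurable N"
  shows "(\<integral>\<^sup>+y. f y \<partial>\<kappa> \<sigma> x) = ennreal (p (\<sigma> j)) * f h1 + ennreal (1 - p (\<sigma> j)) * f h2"
proof (rule nn_integral_two_point)
  have x: "x \<in> space M" using assms X_subset[of j] by auto
  show "prob_space (\<kappa> \<sigma> x)" "sets (\<kappa> \<sigma> x) = sets N" using kernel[OF assms(1) x] by auto
qed (use assms cond_edge[of \<sigma> j x] h_neq in auto)

section \<open>Conditional risks and the comparison of predictions\<close>

text \<open>On \<open>X 0\<close> the kernel is arbitrary and the conditional risk may be infinite
  or undefined at a point, so its two parts are kept apart as extended nonnegative numbers.\<close>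

definition pos_loss :: "(nat \<Rightarrow> sign) \<Rightarrow> ('x \<Rightarrow> 'y) \<Rightarrow> 'x \<Rightarrow> ennreal" where
  "pos_loss \<sigma> g x = (\<integral>\<^sup>+y. ennreal (loss y (g x)) \<partial>\<kappa> \<sigma> x)"

definition neg_loss :: "(nat \<Rightarrow> sign) \<Rightarrow> ('x \<Rightarrow> 'y) \<Rightarrow> 'x \<Rightarrow> ennreal" where
  "neg_loss \<sigma> g x = (\<integral>\<^sup>+y. ennreal (- loss y (g x)) \<partial>\<kappa> \<sigma> x)"

lemma loss_parts_measurable:
  assumes \<sigma>: "\<sigma> \<in> sign_vectors m" and [measurable]: "g \<in> M \<rightarrow>\<^sub>M N"
  shows "pos_loss \<sigma> g \<in> borel_measurable M" "neg_loss \<sigma> g \<in> borel_measurable M"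
proof -
  have [measurable]: "\<kappa> \<sigma> \<in> M \<rightarrow>\<^sub>M subprob_algebra N"
    by (rule measurable_prob_algebraD[OF kernel_measurable[OF \<sigma>]])
  show "pos_loss \<sigma> g \<in> borel_measurable M"
    unfolding pos_loss_def[abs_def]
    by (rule nn_integral_measurable_subprob_algebra2[where N=N]) (auto simp: split_beta')
  show "neg_loss \<sigma> g \<in> borel_measurable M"
    unfolding neg_loss_def[abs_def]
    by (rule nn_integral_measurable_subprob_algebra2[where N=N]) (auto simp: split_beta')
qed

lemma nn_integral_loss_parts:
  assumes \<sigma>: "\<sigma> \<in> sign_vectors m" and [measurable]: "g \<in> M \<rightarrow>\<^sub>M N"
  shows "(\<integral>\<^sup>+(x, y). ennreal (loss y (g x)) \<partial>P \<sigma>) = (\<integral>\<^sup>+x. pos_loss \<sigma> g x \<partial>\<mu>)"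
    and "(\<integral>\<^sup>+(x, y). ennreal (- loss y (g x)) \<partial>P \<sigma>) = (\<integral>\<^sup>+x. neg_loss \<sigma> g x \<partial>\<mu>)"
  unfolding pos_loss_def neg_loss_def by (subst nn_integral_P[OF \<sigma>]; simp add: split_beta')+

lemma risk_P:
  assumes "\<sigma> \<in> sign_vectors m" "g \<in> M \<rightarrow>\<^sub>M N"
  shows "risk loss (P \<sigma>) g
    = enn2ereal (\<integral>\<^sup>+x. pos_loss \<sigma> g x \<partial>\<mu>) - enn2ereal (\<integral>\<^sup>+x. neg_loss \<sigma> g x \<partial>\<mu>)"
  unfolding risk_eq nn_integral_loss_parts[OF assms] ..

lemma neg_loss_finite:
  assumes "\<sigma> \<in> sign_vectors m" "g \<in> M \<rightarrow>\<^sub>M N"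
  obtains b where "(\<integral>\<^sup>+x. neg_loss \<sigma> g x \<partial>\<mu>) = ennreal b" "0 \<le> b"
proof -
  have "(\<integral>\<^sup>+x. neg_loss \<sigma> g x \<partial>\<mu>) < \<infinity>"
    using well_defined[OF assms(1)] assms(2)
    unfolding excess_risk_well_defined_def nn_integral_loss_parts(2)[OF assms, symmetric] by blast
  then show ?thesis using that by (cases "\<integral>\<^sup>+x. neg_loss \<sigma> g x \<partial>\<mu>") auto
qed

lemma optimal_riskE:
  assumes "\<sigma> \<in> sign_vectors m"
  obtains t where "optimal_risk M N loss (P \<sigma>) = ereal t"
  using well_defined[OF assms] unfolding excess_risk_well_defined_def by auto

lemma optimal_risk_le:
  "g \<in> M \<rightarrow>\<^sub>M N \<Longrightarrow> optimal_risk M N loss Q \<le> risk loss Q g"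
  unfolding optimal_risk_def by (rule INF_lower)

text \<open>On an edge block the kernel charges two points only, so both parts are finite there and
  may be subtracted.\<close>

lemma loss_parts_edge:
  assumes \<sigma>: "\<sigma> \<in> sign_vectors m" and j: "j \<in> {1..m}" "x \<in> X j" and g: "g x \<in> space N"
  obtains a b where "pos_loss \<sigma> g x = ennreal a" "neg_loss \<sigma> g x = ennreal b" "0 \<le> a" "0 \<le> b"
    "a - b = \<phi>y (p (\<sigma> j)) (g x)"
proof -
  have "(\<lambda>y. ennreal (loss y (g x))) \<in> borel_measurable N" "(\<lambda>y. ennreal (- loss y (g x))) \<in> borel_measurable N"
    using g by measurable
  note * = this[THEN nn_integral_kernel_edge[OF \<sigma> j]]
  show ?thesis
    by (rule two_point_parts[of "p (\<sigma> j)" "loss h1 (g x)" "loss h2 (g x)"])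
      (use p01 that in \<open>auto simp: pos_loss_def neg_loss_def * varphi_def\<close>)
qed

text \<open>Subtraction-free form of comparing the conditional risks of \<open>g\<close> and \<open>g'\<close> pointwise: neither
  conditional risk is assumed to be finite.\<close>

lemma optimal_risk_compare:
  assumes \<sigma>: "\<sigma> \<in> sign_vectors m" and g: "g \<in> M \<rightarrow>\<^sub>M N" and g': "g' \<in> M \<rightarrow>\<^sub>M N"
    and d: "d \<in> borel_measurable M" and e: "0 \<le> e"
    and le: "\<And>x. x \<in> space M \<Longrightarrow>
      pos_loss \<sigma> g' x + neg_loss \<sigma> g x + d x \<le> pos_loss \<sigma> g x + neg_loss \<sigma> g' x + ennreal e"
  shows "optimal_risk M N loss (P \<sigma>) + enn2ereal (\<integral>\<^sup>+x. d x \<partial>\<mu>) \<le> risk loss (P \<sigma>) g + ereal e"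
proof -
  note [measurable] = loss_parts_measurable[OF \<sigma> g] loss_parts_measurable[OF \<sigma> g'] d
  let ?A = "\<integral>\<^sup>+x. pos_loss \<sigma> g x \<partial>\<mu>" and ?A' = "\<integral>\<^sup>+x. pos_loss \<sigma> g' x \<partial>\<mu>" and ?D = "\<integral>\<^sup>+x. d x \<partial>\<mu>"
  obtain b where b: "(\<integral>\<^sup>+x. neg_loss \<sigma> g x \<partial>\<mu>) = ennreal b" "0 \<le> b" by (rule neg_loss_finite[OF \<sigma> g])
  obtain b' where b': "(\<integral>\<^sup>+x. neg_loss \<sigma> g' x \<partial>\<mu>) = ennreal b'" "0 \<le> b'" by (rule neg_loss_finite[OF \<sigma> g'])
  obtain t where t: "optimal_risk M N loss (P \<sigma>) = ereal t" by (rule optimal_riskE[OF \<sigma>])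
  have "(\<integral>\<^sup>+x. pos_loss \<sigma> g' x + neg_loss \<sigma> g x + d x \<partial>\<mu>)
    \<le> (\<integral>\<^sup>+x. pos_loss \<sigma> g x + neg_loss \<sigma> g' x + ennreal e \<partial>\<mu>)"
    using le by (intro nn_integral_mono) auto
  then have ineq: "?A' + ennreal b + ?D \<le> ?A + ennreal b' + ennreal e"
    by (simp add: nn_integral_add \<mu>.emeasure_space_1[simplified] b b')
  have opt: "ereal t \<le> enn2ereal ?A' - ereal b'"
    using optimal_risk_le[OF g', of "P \<sigma>"] b' unfolding risk_P[OF \<sigma> g'] t by simp
  \<comment> \<open>If \<open>?A\<close> is finite, \<open>ineq\<close> forces every integral on its
    left to be finite and the comparison is one of real numbers. If \<open>?A\<close> is infinite,
    so is the risk of \<open>g\<close>, its negative part being finite.\<close>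
  show ?thesis
  proof (cases ?A)
    case (real a)
    then have fin: "ennreal (a + b' + e) \<ge> ?A' + ennreal b + ?D" using ineq b' e by simp
    then obtain a' where a': "?A' = ennreal a'" "0 \<le> a'" by (cases ?A') (auto simp: top_unique)
    obtain \<delta> where \<delta>: "?D = ennreal \<delta>" "0 \<le> \<delta>" using fin by (cases ?D) (auto simp: top_unique)
    have "ennreal (a' + b + \<delta>) \<le> ennreal (a + b' + e)" using fin a' \<delta> b by simp
    then have "a' + b + \<delta> \<le> a + b' + e" using real b' e by (subst (asm) ennreal_le_iff) auto
    moreover have "t \<le> a' - b'" using opt a' by simp
    ultimately show ?thesis unfolding risk_P[OF \<sigma> g] t using real b \<delta> by simp
  next
    case top
    then show ?thesis unfolding risk_P[OF \<sigma> g] using b by simp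
  qed
qed

section \<open>Lower bounds for the conditional risks on the edge blocks\<close>

text \<open>A finite optimal risk \<open>t\<close> prevents arbitrarily small conditional risks.
  Overwrite a prediction of finite risk by the constant \<open>y\<close> on \<open>X 1\<close>: the
  result has risk at least \<open>t\<close> and at most \<open>a + w * \<phi>y (p s) y\<close>, with
  \<open>a\<close> the integral of the positive part of the original loss.\<close>

lemma bdd_below_varphi:
  assumes w: "0 < w"
  shows "bdd_below (\<phi>y (p s) ` space N)"
proof -
  let ?\<sigma> = "\<lambda>j\<in>{1..m}. s"
  have \<sigma>: "?\<sigma> \<in> sign_vectors m" by (rule const_sign_vector)
  have m1: "1 \<in> {1..m}" using m by simp
  note [measurable] = X_sets[of 1]
  obtain t where t: "optimal_risk M N loss (P ?\<sigma>) = ereal t" by (rule optimal_riskE[OF \<sigma>])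
  \<comment> \<open>A prediction of finite risk exists because the infimum is below infinity. Its
    negative part is finite, hence so is its positive part \<open>a\<close>.\<close>
  then have "optimal_risk M N loss (P ?\<sigma>) < \<infinity>" by simp
  then obtain g where g: "g \<in> M \<rightarrow>\<^sub>M N" "risk loss (P ?\<sigma>) g < \<infinity>"
    unfolding optimal_risk_def INF_less_iff by blast
  obtain b where b: "(\<integral>\<^sup>+x. neg_loss ?\<sigma> g x \<partial>\<mu>) = ennreal b" "0 \<le> b" by (rule neg_loss_finite[OF \<sigma> g(1)])
  obtain a where a: "(\<integral>\<^sup>+x. pos_loss ?\<sigma> g x \<partial>\<mu>) = ennreal a" "0 \<le> a"
    using g(2) b unfolding risk_P[OF \<sigma> g(1)] by (cases "\<integral>\<^sup>+x. pos_loss ?\<sigma> g x \<partial>\<mu>") auto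
  have "(t - a) / w \<le> \<phi>y (p s) y" if y: "y \<in> space N" for y
  proof -
    define g' where "g' x = (if x \<in> X 1 then y else g x)" for x
    have g': "g' \<in> M \<rightarrow>\<^sub>M N" unfolding g'_def using y g(1) m by measurable
    note [measurable] = loss_parts_measurable[OF \<sigma> g(1)] loss_parts_measurable[OF \<sigma> g']
    obtain b' where b': "(\<integral>\<^sup>+x. neg_loss ?\<sigma> g' x \<partial>\<mu>) = ennreal b'" "0 \<le> b'" by (rule neg_loss_finite[OF \<sigma> g'])
    let ?f = "\<phi>y (p s) y"
    \<comment> \<open>The sign of \<open>?f\<close> is unknown, so its positive and negative parts
      stand on opposite sides; off \<open>X 1\<close> both predictions agree.\<close>
    have "(\<integral>\<^sup>+x. pos_loss ?\<sigma> g' x + ennreal (- ?f) * indicator (X 1) x \<partial>\<mu>)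
      \<le> (\<integral>\<^sup>+x. pos_loss ?\<sigma> g x + neg_loss ?\<sigma> g' x + ennreal ?f * indicator (X 1) x \<partial>\<mu>)"
    proof (rule nn_integral_mono)
      fix x assume "x \<in> space \<mu>"
      show "pos_loss ?\<sigma> g' x + ennreal (- ?f) * indicator (X 1) x
        \<le> pos_loss ?\<sigma> g x + neg_loss ?\<sigma> g' x + ennreal ?f * indicator (X 1) x"
      proof (cases "x \<in> X 1")
        case True
        with y have "g' x \<in> space N" by (simp add: g'_def)
        then obtain u v where uv: "pos_loss ?\<sigma> g' x = ennreal u" "neg_loss ?\<sigma> g' x = ennreal v" "0 \<le> u" "0 \<le> v"
          "u - v = ?f"
          using loss_parts_edge[OF \<sigma> m1 True, of g'] True m1 by (auto simp: g'_def)
        have "ennreal u + ennreal (- ?f) \<le> ennreal v + ennreal ?f"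
          using uv by (cases "?f \<ge> 0") (simp_all add: ennreal_neg ennreal_plus[symmetric] ennreal_leI del: ennreal_plus)
        also have "\<dots> \<le> pos_loss ?\<sigma> g x + (ennreal v + ennreal ?f)" by simp
        finally show ?thesis using uv True by (simp add: add.assoc)
      qed (simp add: g'_def pos_loss_def)
    qed
    then have ineq: "(\<integral>\<^sup>+x. pos_loss ?\<sigma> g' x \<partial>\<mu>) + ennreal (- ?f) * ennreal w \<le> ennreal a + ennreal b' + ennreal ?f * ennreal w"
      using m by (simp add: nn_integral_add nn_integral_cmult_indicator a b' emeasure_edge[OF m1, simplified])
    have finite: "ennreal a + ennreal b' + ennreal ?f * ennreal w < top" by (simp add: ennreal_mult_less_top)
    obtain a' where a': "(\<integral>\<^sup>+x. pos_loss ?\<sigma> g' x \<partial>\<mu>) = ennreal a'" "0 \<le> a'"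
      using ineq finite by (cases "\<integral>\<^sup>+x. pos_loss ?\<sigma> g' x \<partial>\<mu>") (auto simp: top_unique)
    have "a' \<le> a + b' + ?f * w"
    proof (cases "?f \<ge> 0")
      case True
      then have "ennreal a' \<le> ennreal (a + b' + ?f * w)"
        using ineq a a' b' w by (simp add: ennreal_neg ennreal_mult)
      then show ?thesis using True a b' w by (subst (asm) ennreal_le_iff) auto
    next
      case False
      then have "ennreal (a' + (- ?f) * w) \<le> ennreal (a + b')"
        using ineq a a' b' w by (subst ennreal_plus, simp, simp add: mult_nonpos_nonneg) (simp add: ennreal_neg flip: ennreal_mult)
      then show ?thesis using a b' by (subst (asm) ennreal_le_iff) auto
    qed
    moreover have "t \<le> a' - b'"
      using optimal_risk_le[OF g', of "P ?\<sigma>"] unfolding risk_P[OF \<sigma> g'] t a' b' using a' b' by simp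
    ultimately show ?thesis using w by (simp add: field_simps)
  qed
  then show ?thesis by (intro bdd_belowI[where m="(t - a) / w"]) auto
qed

lemma phi_le:
  assumes "0 < w" "y \<in> space N"
  shows "\<phi> (p s) \<le> \<phi>y (p s) y"
  unfolding phi_def by (rule cINF_lower[OF bdd_below_varphi[OF assms(1)] assms(2)])

text \<open>Involves the vertex only through its sign at \<open>j\<close>, which makes the pairing
  of vertices possible. For \<open>0 < w\<close> and a prediction function \<open>g\<close> the
  integrand is nonnegative by \<open>phi_le\<close>, so \<open>ennreal\<close> truncates
  nothing.\<close>

definition edge_excess :: "nat \<Rightarrow> sign \<Rightarrow> ('x \<Rightarrow> 'y) \<Rightarrow> ennreal" where
  "edge_excess j s g = (\<integral>\<^sup>+x\<in>X j. ennreal (\<phi>y (p s) (g x) - \<phi> (p s)) \<partial>\<mu>)"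

text \<open>The competitor of \<open>g\<close> is nearly optimal on each edge block and equals
  \<open>g\<close> on \<open>X 0\<close>, where possibly infinite conditional risks are then the
  same on both sides.\<close>

lemma risk_ge:
  assumes w: "0 < w" and \<sigma>: "\<sigma> \<in> sign_vectors m" and g[measurable]: "g \<in> M \<rightarrow>\<^sub>M N"
  shows "optimal_risk M N loss (P \<sigma>) + enn2ereal (\<Sum>j\<in>{1..m}. edge_excess j (\<sigma> j) g) \<le> risk loss (P \<sigma>) g"
proof (rule ereal_le_epsilon2)
  fix e :: real assume e: "0 < e"
  note [measurable] = X_sets
  \<comment> \<open>The infimum need not be attained, so for each sign a minimiser up to
    \<open>e\<close> is chosen; \<open>e\<close> is arbitrary.\<close>
  have "\<exists>y\<in>space N. \<phi>y (p s) y < \<phi> (p s) + e" for s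
    using cInf_lessD[of "\<phi>y (p s) ` space N" "\<phi> (p s) + e"] h_space e by (auto simp: phi_def)
  then obtain y where y: "\<And>s. y s \<in> space N" "\<And>s. \<phi>y (p s) (y s) < \<phi> (p s) + e" by metis
  \<comment> \<open>Off \<open>X 0\<close> only two values occur, selected by the sign of the block;
    collecting the blocks of sign \<open>Plus\<close> into one measurable set makes
    \<open>g'\<close> measurable.\<close>
  let ?Pl = "\<Union>j\<in>{j\<in>{1..m}. \<sigma> j = Plus}. X j"
  define g' where "g' x = (if x \<in> X 0 then g x else if x \<in> ?Pl then y Plus else y Minus)" for x
  have g': "g' \<in> M \<rightarrow>\<^sub>M N" unfolding g'_def using y by measurable
  have g'_edge: "g' x = y (\<sigma> j)" if "j \<in> {1..m}" "x \<in> X j" for j x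
  proof -
    have "x \<notin> X 0" using block_notin[of x j 0] that by simp
    moreover have "x \<in> ?Pl \<longleftrightarrow> \<sigma> j = Plus" using block_notin[of x j] that by fastforce
    ultimately show ?thesis unfolding g'_def by (cases "\<sigma> j") auto
  qed
  define d where "d x = (\<Sum>j\<in>{1..m}. ennreal (\<phi>y (p (\<sigma> j)) (g x) - \<phi> (p (\<sigma> j))) * indicator (X j) x)" for x
  have d_meas: "d \<in> borel_measurable M" unfolding d_def by measurable
  have int_d: "(\<integral>\<^sup>+x. d x \<partial>\<mu>) = (\<Sum>j\<in>{1..m}. edge_excess j (\<sigma> j) g)"
    unfolding d_def edge_excess_def by (rule nn_integral_sum) measurable
  have "pos_loss \<sigma> g' x + neg_loss \<sigma> g x + d x \<le> pos_loss \<sigma> g x + neg_loss \<sigma> g' x + ennreal e"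
    if x: "x \<in> space M" for x
    using x
  proof (cases rule: blockE)
    case 1
    then have "d x = 0" using block_notin[of x 0] by (simp add: d_def)
    with 1 show ?thesis by (simp add: g'_def pos_loss_def neg_loss_def)
  next
    case (2 j)
    have "d x = (\<Sum>i\<in>{1..m}. if i = j then ennreal (\<phi>y (p (\<sigma> j)) (g x) - \<phi> (p (\<sigma> j))) else 0)"
      unfolding d_def using 2 block_notin[of x j] by (intro sum.cong) (auto simp: indicator_def)
    then have d: "d x = ennreal (\<phi>y (p (\<sigma> j)) (g x) - \<phi> (p (\<sigma> j)))" using 2 by simp
    have gN: "g x \<in> space N" "g' x \<in> space N" using measurable_space[OF g x] measurable_space[OF g' x] by auto
    obtain a b where ab: "pos_loss \<sigma> g x = ennreal a" "neg_loss \<sigma> g x = ennreal b" "0 \<le> a" "0 \<le> b"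
      "a - b = \<phi>y (p (\<sigma> j)) (g x)" by (rule loss_parts_edge[where g=g, OF \<sigma> 2 gN(1)])
    obtain a' b' where ab': "pos_loss \<sigma> g' x = ennreal a'" "neg_loss \<sigma> g' x = ennreal b'" "0 \<le> a'" "0 \<le> b'"
      "a' - b' = \<phi>y (p (\<sigma> j)) (g' x)" by (rule loss_parts_edge[where g=g', OF \<sigma> 2 gN(2)])
    have "\<phi> (p (\<sigma> j)) \<le> \<phi>y (p (\<sigma> j)) (g x)" by (rule phi_le[OF w gN(1)])
    moreover have "\<phi>y (p (\<sigma> j)) (g' x) < \<phi> (p (\<sigma> j)) + e" using y g'_edge[OF 2] by simp
    ultimately show ?thesis using ab ab' e unfolding d
      by (simp add: ennreal_plus[symmetric] ennreal_leI del: ennreal_plus)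
  qed
  from optimal_risk_compare[OF \<sigma> g g' d_meas less_imp_le[OF e] this]
  show "optimal_risk M N loss (P \<sigma>) + enn2ereal (\<Sum>j\<in>{1..m}. edge_excess j (\<sigma> j) g) \<le> risk loss (P \<sigma>) g + ereal e"
    by (simp add: int_d)
qed

section \<open>Training samples and expected risks\<close>

abbreviation samples :: "nat \<Rightarrow> (nat \<Rightarrow> 'x \<times> 'y) measure" where
  "samples n \<equiv> \<Pi>\<^sub>M i\<in>{1..n}. M \<Otimes>\<^sub>M N"

lemma sets_training[simp, measurable_cong]:
  "\<sigma> \<in> sign_vectors m \<Longrightarrow> sets (training_distr n (P \<sigma>)) = sets (samples n)"
  by (rule training_distr_sets) simp

lemma space_training[simp]:
  "\<sigma> \<in> sign_vectors m \<Longrightarrow> space (training_distr n (P \<sigma>)) = space (samples n)"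
  by (rule sets_eq_imp_space_eq) simp

lemma prob_space_training: "\<sigma> \<in> sign_vectors m \<Longrightarrow> prob_space (training_distr n (P \<sigma>))"
  by (intro prob_space_training_distr prob_space_P)

lemma estimator_measurable:
  assumes "estimator M N n ghat" "z \<in> space (samples n)"
  shows "ghat z \<in> M \<rightarrow>\<^sub>M N"
  using measurable_compose[OF measurable_Pair1'[OF assms(2), of M] assms(1)[unfolded estimator_def]]
  by simp

lemma estimator_risk_measurable:
  assumes \<sigma>: "\<sigma> \<in> sign_vectors m" and ghat: "estimator M N n ghat"
  shows "(\<lambda>z. risk loss (P \<sigma>) (ghat z)) \<in> borel_measurable (samples n)"
proof -
  interpret prob_space "P \<sigma>" by (rule prob_space_P[OF \<sigma>])
  note [measurable_cong] = sets_P[OF \<sigma>]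
  have [measurable]: "(\<lambda>(z, x). ghat z x) \<in> samples n \<Otimes>\<^sub>M M \<rightarrow>\<^sub>M N"
    using ghat by (simp add: estimator_def)
  have "(\<lambda>a. (\<lambda>(z, x). ghat z x) (fst a, fst (snd a))) \<in> samples n \<Otimes>\<^sub>M (M \<Otimes>\<^sub>M N) \<rightarrow>\<^sub>M N"
    by measurable
  then have [measurable]: "(\<lambda>a. ghat (fst a) (fst (snd a))) \<in> samples n \<Otimes>\<^sub>M P \<sigma> \<rightarrow>\<^sub>M N"
    using \<sigma> by (simp cong: measurable_cong_sets)
  show ?thesis
    unfolding risk_eq split_beta' by measurable
qed

lemma edge_excess_measurable:
  assumes ghat: "estimator M N n ghat" and j: "j \<in> {1..m}"
  shows "(\<lambda>z. edge_excess j s (ghat z)) \<in> borel_measurable (samples n)"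
proof -
  have [measurable]: "X j \<in> sets M" using X_sets j by simp
  have "(\<lambda>a. (\<lambda>(z, x). ghat z x) a) \<in> samples n \<Otimes>\<^sub>M M \<rightarrow>\<^sub>M N"
    using ghat by (simp add: estimator_def)
  then have [measurable]: "(\<lambda>a. ghat (fst a) (snd a)) \<in> samples n \<Otimes>\<^sub>M \<mu> \<rightarrow>\<^sub>M N"
    by (simp add: split_beta' cong: measurable_cong_sets)
  show ?thesis unfolding edge_excess_def by measurable
qed

text \<open>The optimal risk is a finite constant, so the pointwise bound can be integrated over the
  samples and the constant moved to the other side afterwards.\<close>

lemma expected_risk_ge:
  assumes \<sigma>: "\<sigma> \<in> sign_vectors m" and ghat: "estimator M N n ghat"
    and d: "d \<in> borel_measurable (samples n)"
    and le: "\<And>z. z \<in> space (samples n) \<Longrightarrow>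
      optimal_risk M N loss (P \<sigma>) + enn2ereal (d z) \<le> risk loss (P \<sigma>) (ghat z)"
  shows "enn2ereal (\<integral>\<^sup>+z. d z \<partial>training_distr n (P \<sigma>))
    \<le> expected_risk loss (P \<sigma>) n ghat - optimal_risk M N loss (P \<sigma>)"
proof -
  obtain t where t: "optimal_risk M N loss (P \<sigma>) = ereal t" by (rule optimal_riskE[OF \<sigma>])
  note meas = measurable_cong_sets[OF sets_training[OF \<sigma>] refl]
  have "ereal t + enn2ereal (\<integral>\<^sup>+z. d z \<partial>training_distr n (P \<sigma>)) \<le> expected_risk loss (P \<sigma>) n ghat"
    unfolding expected_risk_def using le d estimator_risk_measurable[OF \<sigma> ghat] \<sigma> t
    by (intro ereal_expectation_ge prob_space_training) (auto simp: meas)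
  then show ?thesis unfolding t by (simp add: ereal_le_minus add.commute)
qed

lemma expected_excess_ge:
  assumes w: "0 < w" and \<sigma>: "\<sigma> \<in> sign_vectors m" and ghat: "estimator M N n ghat"
  shows "enn2ereal (\<Sum>j\<in>{1..m}. \<integral>\<^sup>+z. edge_excess j (\<sigma> j) (ghat z) \<partial>training_distr n (P \<sigma>))
    \<le> expected_risk loss (P \<sigma>) n ghat - optimal_risk M N loss (P \<sigma>)"
proof -
  note meas = measurable_cong_sets[OF sets_training[OF \<sigma>] refl]
  have "(\<Sum>j\<in>{1..m}. \<integral>\<^sup>+z. edge_excess j (\<sigma> j) (ghat z) \<partial>training_distr n (P \<sigma>))
    = (\<integral>\<^sup>+z. (\<Sum>j\<in>{1..m}. edge_excess j (\<sigma> j) (ghat z)) \<partial>training_distr n (P \<sigma>))"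
    using edge_excess_measurable[OF ghat] by (intro nn_integral_sum[symmetric]) (simp add: meas)
  also have "enn2ereal \<dots> \<le> expected_risk loss (P \<sigma>) n ghat - optimal_risk M N loss (P \<sigma>)"
    using edge_excess_measurable[OF ghat] risk_ge[OF w \<sigma>] estimator_measurable[OF ghat]
    by (intro expected_risk_ge[OF \<sigma> ghat] borel_measurable_sum) auto
  finally show ?thesis .
qed

text \<open>Handles the cases in which the similarity is 0: a null edge probability, or
  representatives whose products lack absolute continuity.\<close>

lemma expected_excess_nonneg:
  assumes \<sigma>: "\<sigma> \<in> sign_vectors m" and ghat: "estimator M N n ghat"
  shows "0 \<le> expected_risk loss (P \<sigma>) n ghat - optimal_risk M N loss (P \<sigma>)"
  using expected_risk_ge[OF \<sigma> ghat, of "\<lambda>_. 0"] optimal_risk_le[OF estimator_measurable[OF ghat]]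
  by (simp add: zero_ennreal.rep_eq)

section \<open>The characteristic function\<close>

text \<open>\<open>\<phi>y q y\<close> is affine in \<open>q\<close>, so at the mixed probability it
  is the same mixture of its values at \<open>p Plus\<close> and \<open>p Minus\<close>, while
  \<open>\<phi>\<close> there lies below it. Multiplying by \<open>u + 1\<close> turns the weights
  into \<open>u\<close> and 1.\<close>

lemma psi_bound:
  assumes w: "0 < w" and y: "y \<in> space N" and u: "0 \<le> u"
  shows "(u + 1) * psi N loss h1 h2 (p Plus) (p Minus) (u / (u + 1))
    \<le> u * (\<phi>y (p Plus) y - \<phi> (p Plus)) + (\<phi>y (p Minus) y - \<phi> (p Minus))"
proof -
  let ?a = "u / (u + 1)"
  let ?q = "?a * p Plus + (1 - ?a) * p Minus"
  have affine: "\<phi>y ?q y' = ?a * \<phi>y (p Plus) y' + (1 - ?a) * \<phi>y (p Minus) y'" for y'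
    unfolding varphi_def by algebra
  have a: "0 \<le> ?a" "?a \<le> 1" using u by auto
  \<comment> \<open>The mixture of the two infima bounds the affine mixture from below, so the
    infimum at \<open>?q\<close> is a genuine one.\<close>
  have "?a * \<phi> (p Plus) + (1 - ?a) * \<phi> (p Minus) \<le> \<phi>y ?q y'" if "y' \<in> space N" for y'
    unfolding affine using a phi_le[OF w that] by (intro add_mono mult_left_mono) auto
  then have "bdd_below (\<phi>y ?q ` space N)" by (intro bdd_belowI) auto
  then have "\<phi> ?q \<le> \<phi>y ?q y" unfolding phi_def using y by (rule cINF_lower)
  then have "psi N loss h1 h2 (p Plus) (p Minus) ?a
    \<le> ?a * (\<phi>y (p Plus) y - \<phi> (p Plus)) + (1 - ?a) * (\<phi>y (p Minus) y - \<phi> (p Minus))"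
    unfolding psi_def affine by (simp add: algebra_simps)
  then have "(u + 1) * psi N loss h1 h2 (p Plus) (p Minus) ?a
    \<le> (u + 1) * (?a * (\<phi>y (p Plus) y - \<phi> (p Plus)) + (1 - ?a) * (\<phi>y (p Minus) y - \<phi> (p Minus)))"
    using u by (intro mult_left_mono) auto
  also have "\<dots> = ((u + 1) * ?a) * (\<phi>y (p Plus) y - \<phi> (p Plus)) + ((u + 1) * (1 - ?a)) * (\<phi>y (p Minus) y - \<phi> (p Minus))"
    by (simp only: distrib_left mult.assoc)
  also have "(u + 1) * ?a = u" using u by simp
  also have "(u + 1) * (1 - ?a) = 1" using u by (simp add: field_simps)
  finally show ?thesis by simp
qed

text \<open>The clipping is the identity at every \<open>u \<ge> 0\<close>; it avoids the values of
  \<open>phi\<close> at arguments where the infimum may be infinite.\<close>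

definition scaled_psi :: "real \<Rightarrow> real" where
  "scaled_psi u = (u + 1) * (\<phi> (max (p Minus) (min (p Plus) (u / (u + 1) * p Plus + (1 - u / (u + 1)) * p Minus)))
     - u / (u + 1) * \<phi> (p Plus) - (1 - u / (u + 1)) * \<phi> (p Minus))"

lemma scaled_psi_eq:
  assumes u: "0 \<le> u"
  shows "(u + 1) * psi N loss h1 h2 (p Plus) (p Minus) (u / (u + 1)) = scaled_psi u"
proof -
  define a where "a = u / (u + 1)"
  have a: "0 \<le> a" "a \<le> 1" using u by (auto simp: a_def)
  have "a * p Plus + (1 - a) * p Minus = p Minus + a * (p Plus - p Minus)" by (simp add: algebra_simps)
  moreover have "a * (p Plus - p Minus) \<le> p Plus - p Minus" "0 \<le> a * (p Plus - p Minus)"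
    using a p by (auto simp: mult_left_le_one_le)
  ultimately have "p Minus \<le> a * p Plus + (1 - a) * p Minus" "a * p Plus + (1 - a) * p Minus \<le> p Plus"
    by linarith+
  then show ?thesis unfolding scaled_psi_def psi_def a_def[symmetric] by simp
qed

text \<open>The infimum may run over uncountably many \<open>y\<close>, so countable operations do
  not suffice. Each \<open>\<phi>y q y\<close> is continuous in \<open>q\<close>, hence the strict
  sublevel sets of the infimum are unions of open sets.\<close>

lemma scaled_psi_measurable:
  assumes w: "0 < w"
  shows "scaled_psi \<in> borel_measurable borel"
proof -
  let ?c = "\<lambda>q. max (p Minus) (min (p Plus) q)"
  have "(\<lambda>q. \<phi> (?c q)) \<in> borel_measurable borel"
  proof (rule borel_measurableI_less)
    fix t :: real
    have "bdd_below (\<phi>y (?c q) ` space N)" for q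
    proof -
      \<comment> \<open>Every clipped argument is a mixture of \<open>p Minus\<close> and
        \<open>p Plus\<close>, the two probabilities at which lower bounds are known; affinity
        carries the bound over.\<close>
      define a where "a = (?c q - p Minus) / (p Plus - p Minus)"
      have a: "0 \<le> a" "a \<le> 1" using p by (auto simp: a_def field_simps)
      have "?c q = a * p Plus + (1 - a) * p Minus"
      proof -
        have "a * (p Plus - p Minus) = ?c q - p Minus" using p by (simp add: a_def)
        then show ?thesis by (simp add: algebra_simps)
      qed
      then have affine: "\<phi>y (?c q) y = a * \<phi>y (p Plus) y + (1 - a) * \<phi>y (p Minus) y" for y
        unfolding varphi_def by algebra
      have "a * \<phi> (p Plus) + (1 - a) * \<phi> (p Minus) \<le> \<phi>y (?c q) y" if "y \<in> space N" for y
        unfolding affine using a phi_le[OF w that] by (intro add_mono mult_left_mono) auto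
      then show ?thesis by (intro bdd_belowI) auto
    qed
    then have "{q \<in> space borel. \<phi> (?c q) < t} = (\<Union>y\<in>space N. {q. \<phi>y (?c q) y < t})"
      unfolding phi_def using h_space by (subst cINF_less_iff) auto
    also have "open \<dots>"
      unfolding varphi_def by (intro open_UN ballI open_Collect_less continuous_intros)
    finally show "{q \<in> space borel. \<phi> (?c q) < t} \<in> sets borel" by simp
  qed
  then show ?thesis unfolding scaled_psi_def[abs_def] by measurable
qed

section \<open>Likelihood ratio of two vertices that differ in one sign\<close>

text \<open>For \<open>0 < p Minus\<close>, the density of a vertex with sign \<open>Plus\<close> at
  \<open>j\<close> with respect to its flip at \<open>j\<close>, whatever the other signs; the
  second denominator is positive since \<open>p Minus < p Plus\<close> and
  \<open>p Plus \<le> 1\<close>.\<close>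

definition ratio :: "nat \<Rightarrow> 'x \<times> 'y \<Rightarrow> real" where
  "ratio j z = (if fst z \<in> X j \<and> snd z = h1 then p Plus / p Minus
     else if fst z \<in> X j \<and> snd z = h2 then (1 - p Plus) / (1 - p Minus) else 1)"

lemma ratio_nonneg: "0 \<le> ratio j z"
  using p by (simp add: ratio_def)

lemma ratio_measurable: "j \<in> {1..m} \<Longrightarrow> ratio j \<in> borel_measurable (M \<Otimes>\<^sub>M N)"
proof -
  assume "j \<in> {1..m}"
  then have [measurable]: "X j \<in> sets M" using X_sets by simp
  have eq: "ratio j = (\<lambda>z. if fst z \<in> X j \<and> snd z \<in> {h1} then p Plus / p Minus
     else if fst z \<in> X j \<and> snd z \<in> {h2} then (1 - p Plus) / (1 - p Minus) else 1)"
    by (simp add: ratio_def fun_eq_iff)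
  show ?thesis unfolding eq by measurable
qed

text \<open>A flip at \<open>j\<close> changes the conditional law on \<open>X j\<close> alone, so
  the two measures are compared kernel by kernel over the common marginal.\<close>

lemma P_flip_density:
  assumes p0: "0 < p Minus" and \<sigma>: "\<sigma> \<in> sign_vectors m" and j: "j \<in> {1..m}"
  shows "P (\<sigma>(j := Plus)) = density (P (\<sigma>(j := Minus))) (\<lambda>z. ennreal (ratio j z))"
proof (rule measure_eqI)
  have \<sigma>s: "\<sigma>(j := s) \<in> sign_vectors m" for s by (rule sign_vectors_upd[OF \<sigma> j])
  show "sets (P (\<sigma>(j := Plus))) = sets (density (P (\<sigma>(j := Minus))) (\<lambda>z. ennreal (ratio j z)))"
    using \<sigma>s by simp
  fix A assume "A \<in> sets (P (\<sigma>(j := Plus)))"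
  then have A[measurable]: "A \<in> sets (M \<Otimes>\<^sub>M N)" using \<sigma>s by simp
  note [measurable] = ratio_measurable[OF j]
  note [measurable_cong] = sets_P[OF \<sigma>s]
  have "emeasure (density (P (\<sigma>(j := Minus))) (\<lambda>z. ennreal (ratio j z))) A
    = (\<integral>\<^sup>+z. ennreal (ratio j z) * indicator A z \<partial>P (\<sigma>(j := Minus)))"
    by (rule emeasure_density) measurable
  also have "\<dots> = (\<integral>\<^sup>+x. \<integral>\<^sup>+y. ennreal (ratio j (x, y)) * indicator A (x, y) \<partial>\<kappa> (\<sigma>(j := Minus)) x \<partial>\<mu>)"
    by (rule nn_integral_P[OF \<sigma>s]) measurable
  also have "\<dots> = (\<integral>\<^sup>+x. \<integral>\<^sup>+y. indicator A (x, y) \<partial>\<kappa> (\<sigma>(j := Plus)) x \<partial>\<mu>)"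
  proof (rule nn_integral_cong)
    fix x assume "x \<in> space \<mu>"
    then have x: "x \<in> space M" by simp
    then have meas: "(\<lambda>y. ennreal (ratio j (x, y)) * indicator A (x, y)) \<in> borel_measurable N"
      "(\<lambda>y. indicator A (x, y) :: ennreal) \<in> borel_measurable N" by measurable
    from x show "(\<integral>\<^sup>+y. ennreal (ratio j (x, y)) * indicator A (x, y) \<partial>\<kappa> (\<sigma>(j := Minus)) x)
      = (\<integral>\<^sup>+y. indicator A (x, y) \<partial>\<kappa> (\<sigma>(j := Plus)) x)"
    proof (cases rule: blockE)
      case 1
      then have "x \<notin> X j" using block_notin[of x 0 j] j by simp
      then show ?thesis using cond_0[OF \<sigma>s[of Minus] \<sigma>s[of Plus] 1] by (simp add: ratio_def)
    next
      case (2 k)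
      show ?thesis
      proof (cases "k = j")
        case True
        have "ennreal (p Minus) * (ennreal (p Plus / p Minus) * v) = ennreal (p Plus) * v"
          "ennreal (1 - p Minus) * (ennreal ((1 - p Plus) / (1 - p Minus)) * v) = ennreal (1 - p Plus) * v" for v
          unfolding mult.assoc[symmetric] using p0 p by (simp_all add: ennreal_mult'[symmetric])
        then show ?thesis using 2 True h_neq
          unfolding meas[THEN nn_integral_kernel_edge[OF \<sigma>s 2]] by (simp add: ratio_def)
      next
        case False
        \<comment> \<open>On the other edge blocks the two kernels are compared through integrals,
          which the masses of \<open>h1\<close> and \<open>h2\<close> determine.\<close>
        then have "x \<notin> X j" using block_notin[of x k j] 2 j by simp
        then show ?thesis using False
          unfolding meas[THEN nn_integral_kernel_edge[OF \<sigma>s 2]] by (simp add: ratio_def)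
      qed
    qed
  qed
  also have "\<dots> = (\<integral>\<^sup>+z. indicator A z \<partial>P (\<sigma>(j := Plus)))"
    by (rule nn_integral_P[OF \<sigma>s, symmetric]) measurable
  also have "\<dots> = emeasure (P (\<sigma>(j := Plus))) A" using \<sigma>s by simp
  finally show "emeasure (P (\<sigma>(j := Plus))) A
    = emeasure (density (P (\<sigma>(j := Minus))) (\<lambda>z. ennreal (ratio j z))) A" ..
qed

lemma training_flip_density:
  assumes p0: "0 < p Minus" and \<sigma>: "\<sigma> \<in> sign_vectors m" and j: "j \<in> {1..m}"
  shows "training_distr n (P (\<sigma>(j := Plus)))
    = density (training_distr n (P (\<sigma>(j := Minus)))) (\<lambda>z. ennreal (\<Prod>i\<in>{1..n}. ratio j (z i)))"
proof -
  have \<sigma>s: "\<sigma>(j := s) \<in> sign_vectors m" for s by (rule sign_vectors_upd[OF \<sigma> j])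
  note [measurable] = ratio_measurable[OF j]
  note [measurable_cong] = sets_P[OF \<sigma>s]
  have "prob_space (density (P (\<sigma>(j := Minus))) (\<lambda>z. ennreal (ratio j z)))"
    using prob_space_P[OF \<sigma>s, of Plus] unfolding P_flip_density[OF assms] .
  then show ?thesis
    unfolding training_distr_def P_flip_density[OF assms] using prob_space_P[OF \<sigma>s, of Minus]
    by (subst PiM_density) (auto simp: prod_ennreal ratio_nonneg)
qed

text \<open>A change of measure writes both excesses under the vertex with sign
  \<open>Minus\<close>, the first with weight \<open>?r z\<close>. For a fixed sample and input the
  same prediction \<open>ghat z x\<close> enters both, so \<open>psi_bound\<close> applies with
  \<open>u = ?r z\<close>; integrating over \<open>X j\<close> gives the factor
  \<open>w\<close>.\<close>

lemma two_point_excess_ge: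
  assumes w: "0 < w" and p0: "0 < p Minus" and \<sigma>: "\<sigma> \<in> sign_vectors m" and j: "j \<in> {1..m}"
    and ghat: "estimator M N n ghat"
  shows "ennreal w * (\<integral>\<^sup>+z. ennreal (scaled_psi (\<Prod>i\<in>{1..n}. ratio j (z i))) \<partial>training_distr n (P (\<sigma>(j := Minus))))
    \<le> (\<integral>\<^sup>+z. edge_excess j Plus (ghat z) \<partial>training_distr n (P (\<sigma>(j := Plus))))
      + (\<integral>\<^sup>+z. edge_excess j Minus (ghat z) \<partial>training_distr n (P (\<sigma>(j := Minus))))"
proof -
  have \<sigma>s: "\<sigma>(j := s) \<in> sign_vectors m" for s by (rule sign_vectors_upd[OF \<sigma> j])
  let ?T = "training_distr n (P (\<sigma>(j := Minus)))"
  let ?r = "\<lambda>z. \<Prod>i\<in>{1..n}. ratio j (z i)"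
  note [measurable] = ratio_measurable[OF j] edge_excess_measurable[OF ghat j] scaled_psi_measurable[OF w]
  note [measurable_cong] = sets_training[OF \<sigma>s]
  have [measurable]: "X j \<in> sets M" using X_sets j by simp
  have r0: "0 \<le> ?r z" for z by (intro prod_nonneg) (simp add: ratio_nonneg)
  have "ennreal w * (\<integral>\<^sup>+z. ennreal (scaled_psi (?r z)) \<partial>?T) = (\<integral>\<^sup>+z. ennreal w * ennreal (scaled_psi (?r z)) \<partial>?T)"
    by (rule nn_integral_cmult[symmetric]) measurable
  also have "\<dots> \<le> (\<integral>\<^sup>+z. ennreal (?r z) * edge_excess j Plus (ghat z) + edge_excess j Minus (ghat z) \<partial>?T)"
  proof (rule nn_integral_mono)
    fix z assume "z \<in> space ?T"
    then have z: "z \<in> space (samples n)" using \<sigma>s by simp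
    have g[measurable]: "ghat z \<in> M \<rightarrow>\<^sub>M N" by (rule estimator_measurable[OF ghat z])
    have "ennreal w * ennreal (scaled_psi (?r z)) = (\<integral>\<^sup>+x. ennreal (scaled_psi (?r z)) * indicator (X j) x \<partial>\<mu>)"
      using X_sets j emeasure_edge[OF j] by (subst nn_integral_cmult_indicator) (auto simp: mult.commute)
    also have "\<dots> \<le> (\<integral>\<^sup>+x. ennreal (?r z) * (ennreal (\<phi>y (p Plus) (ghat z x) - \<phi> (p Plus)) * indicator (X j) x)
        + ennreal (\<phi>y (p Minus) (ghat z x) - \<phi> (p Minus)) * indicator (X j) x \<partial>\<mu>)"
    proof (rule nn_integral_mono)
      fix x assume "x \<in> space \<mu>"
      then have gx: "ghat z x \<in> space N" using measurable_space[OF g] by simp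
      have "scaled_psi (?r z) \<le> ?r z * (\<phi>y (p Plus) (ghat z x) - \<phi> (p Plus)) + (\<phi>y (p Minus) (ghat z x) - \<phi> (p Minus))"
        using psi_bound[OF w gx r0[of z]] unfolding scaled_psi_eq[OF r0] .
      then have "ennreal (scaled_psi (?r z)) \<le> ennreal (?r z) * ennreal (\<phi>y (p Plus) (ghat z x) - \<phi> (p Plus))
        + ennreal (\<phi>y (p Minus) (ghat z x) - \<phi> (p Minus))"
        using phi_le[OF w gx, of Plus] phi_le[OF w gx, of Minus] r0[of z]
        by (simp add: ennreal_mult'[symmetric] ennreal_plus[symmetric] ennreal_leI del: ennreal_plus)
      then show "ennreal (scaled_psi (?r z)) * indicator (X j) x
        \<le> ennreal (?r z) * (ennreal (\<phi>y (p Plus) (ghat z x) - \<phi> (p Plus)) * indicator (X j) x)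
        + ennreal (\<phi>y (p Minus) (ghat z x) - \<phi> (p Minus)) * indicator (X j) x"
        by (simp add: indicator_def)
    qed
    also have "\<dots> = ennreal (?r z) * edge_excess j Plus (ghat z) + edge_excess j Minus (ghat z)"
      unfolding edge_excess_def by (subst nn_integral_add, measurable) (subst nn_integral_cmult, auto)
    finally show "ennreal w * ennreal (scaled_psi (?r z))
      \<le> ennreal (?r z) * edge_excess j Plus (ghat z) + edge_excess j Minus (ghat z)" .
  qed
  also have "\<dots> = (\<integral>\<^sup>+z. ennreal (?r z) * edge_excess j Plus (ghat z) \<partial>?T) + (\<integral>\<^sup>+z. edge_excess j Minus (ghat z) \<partial>?T)"
    by (rule nn_integral_add) measurable
  also have "(\<integral>\<^sup>+z. ennreal (?r z) * edge_excess j Plus (ghat z) \<partial>?T)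
    = (\<integral>\<^sup>+z. edge_excess j Plus (ghat z) \<partial>training_distr n (P (\<sigma>(j := Plus))))"
    unfolding training_flip_density[OF p0 \<sigma> j] by (rule nn_integral_density[symmetric]) measurable
  finally show ?thesis .
qed

text \<open>The integral of \<open>F\<close> against the law of \<open>ratio j\<close> under a
  vertex with sign \<open>Minus\<close> at \<open>j\<close>: atoms at the two quotients, and one at
  1 of mass \<open>1 - w\<close> from outside the block. It involves neither \<open>j\<close> nor
  the other signs.\<close>

definition ratio_law :: "(real \<Rightarrow> ennreal) \<Rightarrow> ennreal" where
  "ratio_law F = (ennreal (p Minus) * F (p Plus / p Minus)
     + ennreal (1 - p Minus) * F ((1 - p Plus) / (1 - p Minus))) * ennreal w
     + F 1 * (1 - ennreal w)"

lemma nn_integral_edge_const: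
  assumes j: "j \<in> {1..m}"
  shows "(\<integral>\<^sup>+x. (if x \<in> X j then C else C') \<partial>\<mu>) = C * ennreal w + C' * (1 - ennreal w)"
proof -
  have Xj: "X j \<in> sets \<mu>" using X_sets j by simp
  have "emeasure \<mu> (space \<mu> - X j) = 1 - ennreal w"
    using Xj emeasure_edge[OF j] by (subst emeasure_compl) (auto simp: \<mu>.emeasure_space_1[simplified])
  then show ?thesis using \<mu>.nn_integral_if_const[OF Xj, of C C'] emeasure_edge[OF j] by simp
qed

text \<open>Outside \<open>X j\<close> the ratio is constantly 1, so the kernel there contributes
  only its total mass one, whatever it is.\<close>

lemma nn_integral_ratio_P:
  assumes \<sigma>: "\<sigma> \<in> sign_vectors m" and j: "j \<in> {1..m}" "\<sigma> j = Minus"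
    and F[measurable]: "F \<in> borel_measurable borel"
  shows "(\<integral>\<^sup>+z. F (ratio j z) \<partial>P \<sigma>) = ratio_law F"
proof -
  note [measurable] = ratio_measurable[OF j(1)]
  have "(\<integral>\<^sup>+z. F (ratio j z) \<partial>P \<sigma>) = (\<integral>\<^sup>+x. \<integral>\<^sup>+y. F (ratio j (x, y)) \<partial>\<kappa> \<sigma> x \<partial>\<mu>)"
    by (rule nn_integral_P[OF \<sigma>]) measurable
  also have "\<dots> = (\<integral>\<^sup>+x. (if x \<in> X j then ennreal (p Minus) * F (p Plus / p Minus)
     + ennreal (1 - p Minus) * F ((1 - p Plus) / (1 - p Minus)) else F 1) \<partial>\<mu>)"
  proof (rule nn_integral_cong)
    fix x assume "x \<in> space \<mu>"
    then have x: "x \<in> space M" by simp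
    then have meas: "(\<lambda>y. F (ratio j (x, y))) \<in> borel_measurable N" by measurable
    show "(\<integral>\<^sup>+y. F (ratio j (x, y)) \<partial>\<kappa> \<sigma> x) = (if x \<in> X j then ennreal (p Minus) * F (p Plus / p Minus)
     + ennreal (1 - p Minus) * F ((1 - p Plus) / (1 - p Minus)) else F 1)"
    proof (cases "x \<in> X j")
      case True
      then show ?thesis using j h_neq
        unfolding nn_integral_kernel_edge[OF \<sigma> j(1) True meas] by (simp add: ratio_def)
    next
      case False
      then show ?thesis using prob_space.emeasure_space_1[OF kernel(1)[OF \<sigma> x]] by (simp add: ratio_def)
    qed
  qed
  finally show ?thesis unfolding nn_integral_edge_const[OF j(1)] ratio_law_def .
qed

end

subsection \<open>Representatives and the lower bound\<close>

locale assouad_hypercube_base = assouad_hypercube +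
  fixes P0 :: "('a \<times> 'b) measure" and \<kappa>0 :: "'a \<Rightarrow> 'b measure"
  assumes P0: "P0 \<in> space (prob_algebra (M \<Otimes>\<^sub>M N))"
    and marginal_0: "distr P0 M fst = \<mu>"
    and cond_base: "is_cond_distr M N P0 \<kappa>0"
    and cond_base_edge: "x \<in> space M - X 0 \<Longrightarrow> measure (\<kappa>0 x) {h1} = 1 / 2 \<and> measure (\<kappa>0 x) {h2} = 1 / 2"
begin


section \<open>The representatives as probability measures\<close>

abbreviation rep :: "sign \<Rightarrow> ('a \<times> 'b) measure" where
  "rep \<equiv> representative X h1 h2 p P0"

lemma edge_1: "1 \<in> {1..m}" using m by simp

lemma X_1_sets[measurable]: "X 1 \<in> sets M" using X_sets m by simp

lemma sets_P0[simp, measurable_cong]: "sets P0 = sets (M \<Otimes>\<^sub>M N)"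
  using P0 by (simp add: space_prob_algebra)

lemma sets_rep[simp, measurable_cong]: "sets (rep s) = sets (M \<Otimes>\<^sub>M N)"
  by (simp add: representative_def)

definition rep_density :: "sign \<Rightarrow> 'a \<times> 'b \<Rightarrow> ennreal" where
  "rep_density s z = ennreal (if fst z \<in> X 1 \<and> snd z = h1 then 2 * p s
        else if fst z \<in> X 1 \<and> snd z = h2 then 2 * (1 - p s) else 1)"

lemma rep_eq_density: "rep s = density P0 (rep_density s)"
  by (simp add: representative_def rep_density_def[abs_def] split_beta')

lemma rep_density_measurable[measurable]: "rep_density s \<in> borel_measurable (M \<Otimes>\<^sub>M N)"
proof -
  have eq: "rep_density s = (\<lambda>z. ennreal (if fst z \<in> X 1 \<and> snd z \<in> {h1} then 2 * p s
        else if fst z \<in> X 1 \<and> snd z \<in> {h2} then 2 * (1 - p s) else 1))"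
    by (simp add: rep_density_def fun_eq_iff)
  show ?thesis unfolding eq by measurable
qed

text \<open>On \<open>X 1\<close> the base gives mass 1/2 to each label and the factor 2 in the
  density cancels it, leaving the two-point law of sign \<open>s\<close>; elsewhere the base kernel
  is untouched.\<close>

lemma nn_integral_rep:
  assumes f[measurable]: "f \<in> borel_measurable (M \<Otimes>\<^sub>M N)"
  shows "(\<integral>\<^sup>+z. f z \<partial>rep s) = (\<integral>\<^sup>+x. (if x \<in> X 1
    then ennreal (p s) * f (x, h1) + ennreal (1 - p s) * f (x, h2) else \<integral>\<^sup>+y. f (x, y) \<partial>\<kappa>0 x) \<partial>\<mu>)"
proof -
  have "(\<integral>\<^sup>+z. f z \<partial>rep s) = (\<integral>\<^sup>+z. rep_density s z * f z \<partial>P0)"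
    unfolding rep_eq_density by (rule nn_integral_density) measurable
  also have "\<dots> = (\<integral>\<^sup>+x. \<integral>\<^sup>+y. rep_density s (x, y) * f (x, y) \<partial>\<kappa>0 x \<partial>\<mu>)"
    unfolding marginal_0[symmetric] by (rule nn_integral_cond_distr[OF P0 cond_base]) measurable
  also have "\<dots> = (\<integral>\<^sup>+x. (if x \<in> X 1
    then ennreal (p s) * f (x, h1) + ennreal (1 - p s) * f (x, h2) else \<integral>\<^sup>+y. f (x, y) \<partial>\<kappa>0 x) \<partial>\<mu>)"
  proof (rule nn_integral_cong)
    fix x assume "x \<in> space \<mu>"
    then have x: "x \<in> space M" by simp
    then have meas: "(\<lambda>y. rep_density s (x, y) * f (x, y)) \<in> borel_measurable N" by measurable
    have \<kappa>0: "prob_space (\<kappa>0 x)" "sets (\<kappa>0 x) = sets N"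
      using measurable_space[of \<kappa>0 M "prob_algebra N" x] cond_base x
      by (auto simp: is_cond_distr_def space_prob_algebra)
    show "(\<integral>\<^sup>+y. rep_density s (x, y) * f (x, y) \<partial>\<kappa>0 x) = (if x \<in> X 1
      then ennreal (p s) * f (x, h1) + ennreal (1 - p s) * f (x, h2) else \<integral>\<^sup>+y. f (x, y) \<partial>\<kappa>0 x)"
    proof (cases "x \<in> X 1")
      case True
      have half: "ennreal (1 / 2) * (ennreal (2 * r) * v) = ennreal r * v" for r v
        unfolding mult.assoc[symmetric] by (subst ennreal_mult'[symmetric]) simp_all
      have "x \<notin> X 0" using block_notin[of x 1 0] m True by simp
      then have "measure (\<kappa>0 x) {h1} = 1 / 2" "measure (\<kappa>0 x) {h2} = 1 - 1 / 2"
        using cond_base_edge[of x] x by auto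
      from nn_integral_two_point[OF \<kappa>0 h_sets h_neq this meas]
      have "(\<integral>\<^sup>+y. rep_density s (x, y) * f (x, y) \<partial>\<kappa>0 x)
        = ennreal (1 / 2) * (ennreal (2 * p s) * f (x, h1)) + ennreal (1 / 2) * (ennreal (2 * (1 - p s)) * f (x, h2))"
        using True h_neq by (simp add: rep_density_def)
      also have "\<dots> = ennreal (p s) * f (x, h1) + ennreal (1 - p s) * f (x, h2)"
        by (simp only: half)
      finally show ?thesis unfolding if_P[OF True] .
    qed (simp add: rep_density_def)
  qed
  finally show ?thesis .
qed

lemma base_kernel: "x \<in> space M \<Longrightarrow> emeasure (\<kappa>0 x) (space (\<kappa>0 x)) = 1"
  using measurable_space[of \<kappa>0 M "prob_algebra N" x] cond_base
  by (auto simp: is_cond_distr_def space_prob_algebra prob_space.emeasure_space_1)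

lemma prob_space_rep: "prob_space (rep s)"
proof (rule prob_spaceI)
  have "emeasure (rep s) (space (rep s)) = (\<integral>\<^sup>+z. 1 \<partial>rep s)" by simp
  also have "\<dots> = (\<integral>\<^sup>+x. 1 \<partial>\<mu>)"
  proof -
    have "ennreal (p s) + ennreal (1 - p s) = 1"
      using p01[of s] by (simp add: ennreal_plus[symmetric] del: ennreal_plus)
    then show ?thesis
      unfolding nn_integral_rep[OF borel_measurable_const] using base_kernel by (intro nn_integral_cong) simp
  qed
  also have "\<dots> = 1" using \<mu>.emeasure_space_1 by simp
  finally show "emeasure (rep s) (space (rep s)) = 1" .
qed

text \<open>On \<open>X 1\<close> the representative has the conditional law that a
  \<open>Minus\<close> vertex has on \<open>X j\<close>, both blocks have mass \<open>w\<close>, and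
  off the block the ratio is 1.\<close>

lemma nn_integral_ratio_rep:
  assumes F[measurable]: "F \<in> borel_measurable borel"
  shows "(\<integral>\<^sup>+z. F (ratio 1 z) \<partial>rep Minus) = ratio_law F"
proof -
  note [measurable] = ratio_measurable[OF edge_1]
  have "(\<integral>\<^sup>+z. F (ratio 1 z) \<partial>rep Minus) = (\<integral>\<^sup>+x. (if x \<in> X 1
    then ennreal (p Minus) * F (ratio 1 (x, h1)) + ennreal (1 - p Minus) * F (ratio 1 (x, h2))
    else \<integral>\<^sup>+y. F (ratio 1 (x, y)) \<partial>\<kappa>0 x) \<partial>\<mu>)"
    by (rule nn_integral_rep) measurable
  also have "\<dots> = (\<integral>\<^sup>+x. (if x \<in> X 1 then ennreal (p Minus) * F (p Plus / p Minus)
     + ennreal (1 - p Minus) * F ((1 - p Plus) / (1 - p Minus)) else F 1) \<partial>\<mu>)"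
    using h_neq base_kernel by (intro nn_integral_cong) (auto simp: ratio_def)
  finally show ?thesis unfolding nn_integral_edge_const[OF edge_1] ratio_law_def .
qed

text \<open>The link between an arbitrary edge \<open>j\<close> of the hypercube and the single edge
  modelled by the representatives: integrals of indicators have the same
  \<open>ratio_law\<close>.\<close>

lemma distr_ratio_eq:
  assumes \<sigma>: "\<sigma> \<in> sign_vectors m" and j: "j \<in> {1..m}" "\<sigma> j = Minus"
  shows "distr (P \<sigma>) borel (ratio j) = distr (rep Minus) borel (ratio 1)"
proof (rule measure_eqI)
  fix A :: "real set" assume "A \<in> sets (distr (P \<sigma>) borel (ratio j))"
  then have A[measurable]: "A \<in> sets borel" by simp
  note [measurable] = ratio_measurable[OF j(1)] ratio_measurable[OF edge_1]
  note [measurable_cong] = sets_P[OF \<sigma>]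
  have "emeasure (distr (P \<sigma>) borel (ratio j)) A = (\<integral>\<^sup>+z. indicator A (ratio j z) \<partial>P \<sigma>)"
    by (subst nn_integral_distr[symmetric, where f="indicator A" and M'=borel]) auto
  also have "\<dots> = (\<integral>\<^sup>+z. indicator A (ratio 1 z) \<partial>rep Minus)"
    using nn_integral_ratio_P[OF \<sigma> j, of "indicator A"] nn_integral_ratio_rep[of "indicator A"] by simp
  also have "\<dots> = emeasure (distr (rep Minus) borel (ratio 1)) A"
    by (subst nn_integral_distr[symmetric, where f="indicator A" and M'=borel]) auto
  finally show "emeasure (distr (P \<sigma>) borel (ratio j)) A = emeasure (distr (rep Minus) borel (ratio 1)) A" .
qed simp

section \<open>Transfer from the vertices to the representatives\<close>

text \<open>The common value of all two-vertex bounds, taken under the representatives;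
  \<open>similarity_le\<close> bounds the similarity by \<open>real m * w / 2\<close> times
  it.\<close>

definition pair_bound :: "nat \<Rightarrow> ennreal" where
  "pair_bound n = (\<integral>\<^sup>+z. ennreal (scaled_psi (\<Prod>i\<in>{1..n}. ratio 1 (z i))) \<partial>training_distr n (rep Minus))"

lemma pair_bound_eq:
  assumes w: "0 < w" and \<sigma>: "\<sigma> \<in> sign_vectors m" and j: "j \<in> {1..m}" "\<sigma> j = Minus"
  shows "(\<integral>\<^sup>+z. ennreal (scaled_psi (\<Prod>i\<in>{1..n}. ratio j (z i))) \<partial>training_distr n (P \<sigma>)) = pair_bound n"
proof -
  note [measurable] = ratio_measurable[OF j(1)] ratio_measurable[OF edge_1] scaled_psi_measurable[OF w]
  note [measurable_cong] = sets_P[OF \<sigma>]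
  show ?thesis
    unfolding pair_bound_def training_distr_def
    using nn_integral_PiM_prod_distr[of "{1..n}" "P \<sigma>" "ratio j" "\<lambda>u. ennreal (scaled_psi u)"]
      nn_integral_PiM_prod_distr[of "{1..n}" "rep Minus" "ratio 1" "\<lambda>u. ennreal (scaled_psi u)"]
      prob_space_P[OF \<sigma>] prob_space_rep distr_ratio_eq[OF \<sigma> j] by simp
qed

text \<open>The densities of the two representatives with respect to the base have quotient
  \<open>ratio 1\<close> at every point, so the base cancels.\<close>

lemma training_rep_density:
  assumes p0: "0 < p Minus"
  shows "training_distr n (rep Plus)
    = density (training_distr n (rep Minus)) (\<lambda>z. ennreal (\<Prod>i\<in>{1..n}. ratio 1 (z i)))"
proof -
  note [measurable] = ratio_measurable[OF edge_1]
  have "rep_density Plus = (\<lambda>z. rep_density Minus z * ennreal (ratio 1 z))"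
  proof
    fix z
    have frac: "2 * a * (b / a) = 2 * b" if "a \<noteq> 0" for a b :: real
      using that by simp
    have cancel: "2 * p Minus * (p Plus / p Minus) = 2 * p Plus"
      "2 * (1 - p Minus) * ((1 - p Plus) / (1 - p Minus)) = 2 * (1 - p Plus)"
      using p0 p by (intro frac; simp)+
    have "(if a then 2 * p Plus else if b then 2 * (1 - p Plus) else 1)
      = (if a then 2 * p Minus else if b then 2 * (1 - p Minus) else 1)
        * (if a then p Plus / p Minus else if b then (1 - p Plus) / (1 - p Minus) else 1)" for a b
      by (cases a; cases b) (simp_all only: if_True if_False cancel mult_1_right)
    then show "rep_density Plus z = rep_density Minus z * ennreal (ratio 1 z)"
      unfolding rep_density_def ratio_def using p0 p by (subst ennreal_mult'[symmetric]) simp_all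
  qed
  then have eq: "rep Plus = density (rep Minus) (\<lambda>z. ennreal (ratio 1 z))"
    unfolding rep_eq_density by (subst density_density_eq) auto
  show ?thesis
    unfolding training_distr_def using prob_space_rep[of Plus] prob_space_rep[of Minus] unfolding eq
    by (subst PiM_density) (auto simp: prod_ennreal ratio_nonneg)
qed

abbreviation sim :: "nat \<Rightarrow> real" where
  "sim n \<equiv> similarity (characteristic_function N loss m w h1 h2 p)
     (training_distr n (rep Plus)) (training_distr n (rep Minus))"

text \<open>Almost everywhere the Radon-Nikodym derivative is the product of the ratios, and at
  nonnegative arguments the characteristic function is \<open>real m * w / 2\<close> times
  \<open>scaled_psi\<close>.\<close>

lemma similarity_le:
  assumes w: "0 < w" and p0: "0 < p Minus"
    and ac: "absolutely_continuous (training_distr n (rep Minus)) (training_distr n (rep Plus))"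
  shows "ennreal (sim n) \<le> ennreal (real m * w / 2) * pair_bound n"
proof -
  let ?T = "training_distr n (rep Minus)" and ?T' = "training_distr n (rep Plus)"
  let ?f = "characteristic_function N loss m w h1 h2 p"
  let ?r = "\<lambda>z. \<Prod>i\<in>{1..n}. ratio 1 (z i)"
  interpret T: prob_space ?T by (intro prob_space_training_distr prob_space_rep)
  note [measurable] = ratio_measurable[OF edge_1] scaled_psi_measurable[OF w]
  have [measurable_cong]: "sets ?T = sets (samples n)" by (rule training_distr_sets) simp
  have r0: "0 \<le> ?r z" for z by (intro prod_nonneg) (simp add: ratio_nonneg)
  have RN: "AE z in ?T. ennreal (?r z) = RN_deriv ?T ?T' z"
    by (rule T.RN_deriv_unique) (use training_rep_density[OF p0, of n] in auto)
  have "ennreal (sim n) \<le> (\<integral>\<^sup>+z. ennreal (?f (enn2real (RN_deriv ?T ?T' z))) \<partial>?T)"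
    unfolding similarity_def using ac by (simp add: integral_le_nn_integral)
  also have "\<dots> = (\<integral>\<^sup>+z. ennreal (real m * w / 2) * ennreal (scaled_psi (?r z)) \<partial>?T)"
  proof (rule nn_integral_cong_AE)
    show "AE z in ?T. ennreal (?f (enn2real (RN_deriv ?T ?T' z)))
      = ennreal (real m * w / 2) * ennreal (scaled_psi (?r z))"
      using RN
    proof eventually_elim
      case (elim z)
      have "enn2real (RN_deriv ?T ?T' z) = ?r z" unfolding elim[symmetric] using r0 by simp
      moreover have "?f (?r z) = (real m * w / 2) * scaled_psi (?r z)"
        unfolding characteristic_function_def scaled_psi_eq[OF r0, symmetric] by (simp only: mult.assoc)
      moreover have "ennreal (real m * w / 2 * scaled_psi (?r z)) = ennreal (real m * w / 2) * ennreal (scaled_psi (?r z))"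
        using w by (intro ennreal_mult') simp
      ultimately show ?case by (simp only:)
    qed
  qed
  also have "\<dots> = ennreal (real m * w / 2) * pair_bound n"
    unfolding pair_bound_def by (rule nn_integral_cmult) measurable
  finally show ?thesis .
qed

text \<open>With \<open>p Minus = 0\<close> the label \<open>h1\<close> on \<open>X 1\<close> has
  mass 0 under the representative of sign \<open>Minus\<close>, but mass
  \<open>p Plus * w > 0\<close> under the other. The event that all \<open>n\<close> points fall
  into \<open>?B\<close> separates the products.\<close>

lemma not_absolutely_continuous:
  assumes w: "0 < w" and p0: "p Minus = 0"
    and n: "1 \<le> n"
  shows "\<not> absolutely_continuous (training_distr n (rep Minus)) (training_distr n (rep Plus))"
proof -
  let ?B = "X 1 \<times> {h1}"
  let ?S = "Pi\<^sub>E {1..n} (\<lambda>_. ?B)"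
  have B[measurable]: "?B \<in> sets (M \<Otimes>\<^sub>M N)" by measurable
  have rep_B: "emeasure (rep s) ?B = ennreal (p s) * ennreal w" for s
  proof -
    have "emeasure (rep s) ?B = (\<integral>\<^sup>+z. indicator ?B z \<partial>rep s)" by simp
    also have "\<dots> = (\<integral>\<^sup>+x. (if x \<in> X 1 then ennreal (p s) else 0) \<partial>\<mu>)"
      using h_neq by (subst nn_integral_rep) (auto intro!: nn_integral_cong)
    finally show ?thesis unfolding nn_integral_edge_const[OF edge_1] by simp
  qed
  have T_S: "emeasure (training_distr n (rep s)) ?S = (ennreal (p s) * ennreal w) ^ n" for s
  proof -
    interpret product_prob_space "\<lambda>_. rep s" "{1..n}"
      by (simp add: product_prob_space_def product_prob_space_axioms_def product_sigma_finite_def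
          prob_space_imp_sigma_finite prob_space_rep)
    show ?thesis unfolding training_distr_def by (subst emeasure_PiM) (auto simp: rep_B)
  qed
  have sets_S: "?S \<in> sets (training_distr n (rep s))" for s
    unfolding training_distr_def by (rule sets_PiM_I_finite) auto
  \<comment> \<open>\<open>1 \<le> n\<close> matters: for an empty sample the power of 0 would be
    1.\<close>
  have "?S \<in> null_sets (training_distr n (rep Minus))"
    using sets_S T_S[of Minus] n p0 by (intro null_setsI) (auto simp: power_0_left)
  moreover have "?S \<notin> null_sets (training_distr n (rep Plus))"
    using T_S[of Plus] n p0 p w by (auto simp: null_sets_def)
  ultimately show ?thesis by (auto simp: absolutely_continuous_def)
qed

section \<open>Averaging over the sign vectors\<close>

text \<open>Each vertex and its flip at \<open>j\<close> form a pair governed by the two-vertex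
  bound. Summing over all vertices meets each pair twice, whence the factor 2.\<close>

lemma sum_excess_ge:
  assumes w: "0 < w" and p0: "0 < p Minus" and j: "j \<in> {1..m}" and ghat: "estimator M N n ghat"
  shows "of_nat (card (sign_vectors m)) * (ennreal w * pair_bound n)
    \<le> 2 * (\<Sum>\<sigma>\<in>sign_vectors m. \<integral>\<^sup>+z. edge_excess j (\<sigma> j) (ghat z) \<partial>training_distr n (P \<sigma>))"
proof -
  let ?e = "\<lambda>\<sigma>. \<integral>\<^sup>+z. edge_excess j (\<sigma> j) (ghat z) \<partial>training_distr n (P \<sigma>)"
  define flip where "flip \<sigma> = \<sigma>(j := if \<sigma> j = Plus then Minus else Plus)" for \<sigma> :: "nat \<Rightarrow> sign"
  have flip_flip: "flip (flip \<sigma>) = \<sigma>" for \<sigma>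
    by (cases "\<sigma> j") (simp_all add: flip_def fun_eq_iff)
  have flip_in: "flip \<sigma> \<in> sign_vectors m" if "\<sigma> \<in> sign_vectors m" for \<sigma>
    unfolding flip_def by (rule sign_vectors_upd[OF that j])
  have "bij_betw flip (sign_vectors m) (sign_vectors m)"
    by (rule bij_betw_byWitness[where f'=flip]) (auto simp: flip_flip flip_in)
  then have sum_flip: "(\<Sum>\<sigma>\<in>sign_vectors m. ?e (flip \<sigma>)) = (\<Sum>\<sigma>\<in>sign_vectors m. ?e \<sigma>)"
    by (rule sum.reindex_bij_betw)
  have pair: "ennreal w * pair_bound n \<le> ?e \<sigma> + ?e (flip \<sigma>)" if \<sigma>: "\<sigma> \<in> sign_vectors m" for \<sigma>
  proof -
    have "ennreal w * pair_bound n \<le> ?e (\<sigma>(j := Plus)) + ?e (\<sigma>(j := Minus))"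
      using two_point_excess_ge[OF w p0 \<sigma> j ghat] pair_bound_eq[OF w sign_vectors_upd[OF \<sigma> j] j, of Minus n]
      by simp
    also have "\<dots> = ?e \<sigma> + ?e (flip \<sigma>)"
    proof (cases "\<sigma> j")
      case Minus
      then have "\<sigma>(j := Minus) = \<sigma>" "flip \<sigma> = \<sigma>(j := Plus)" by (simp_all add: flip_def fun_eq_iff)
      then show ?thesis by (simp only: add.commute)
    next
      case Plus
      then have "\<sigma>(j := Plus) = \<sigma>" "flip \<sigma> = \<sigma>(j := Minus)" by (simp_all add: flip_def fun_eq_iff)
      then show ?thesis by simp
    qed
    finally show ?thesis .
  qed
  have "of_nat (card (sign_vectors m)) * (ennreal w * pair_bound n) = (\<Sum>\<sigma>\<in>sign_vectors m. ennreal w * pair_bound n)"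
    by simp
  also have "\<dots> \<le> (\<Sum>\<sigma>\<in>sign_vectors m. ?e \<sigma> + ?e (flip \<sigma>))" by (rule sum_mono) (rule pair)
  also have "\<dots> = 2 * (\<Sum>\<sigma>\<in>sign_vectors m. ?e \<sigma>)" unfolding sum.distrib sum_flip by (simp add: mult_2)
  finally show ?thesis .
qed

lemma card_sign_vectors: "finite (sign_vectors m)" "0 < card (sign_vectors m)"
proof -
  have "(UNIV :: sign set) = {Minus, Plus}" using sign.exhaust by auto
  then have "finite (UNIV :: sign set)" by (metis finite.emptyI finite_insert)
  then show fin: "finite (sign_vectors m)" unfolding sign_vectors_def by (intro finite_PiE) auto
  show "0 < card (sign_vectors m)" using const_sign_vector fin by (auto simp: card_gt_0_iff)
qed

text \<open>A bound \<open>K\<close> for all vertices also bounds their average. Summing the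
  one-edge bounds over the \<open>m\<close> edges and exchanging the sums leaves the number of
  vertices and a factor 2 on both sides; both are positive and finite, so they cancel.\<close>

lemma pair_bound_le:
  assumes w: "0 < w" and p0: "0 < p Minus" and ghat: "estimator M N n ghat"
    and K: "\<And>\<sigma>. \<sigma> \<in> sign_vectors m \<Longrightarrow>
      (\<Sum>j\<in>{1..m}. \<integral>\<^sup>+z. edge_excess j (\<sigma> j) (ghat z) \<partial>training_distr n (P \<sigma>)) \<le> K"
  shows "ennreal (real m * w / 2) * pair_bound n \<le> K"
proof -
  let ?c = "of_nat (card (sign_vectors m)) :: ennreal"
  let ?e = "\<lambda>j \<sigma>. \<integral>\<^sup>+z. edge_excess j (\<sigma> j) (ghat z) \<partial>training_distr n (P \<sigma>)"
  have half: "2 * ennreal (real m * w / 2) = of_nat m * ennreal w"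
    using w by (simp add: ennreal_of_nat_eq_real_of_nat ennreal_mult'[symmetric] flip: ennreal_numeral)
  have "?c * (2 * (ennreal (real m * w / 2) * pair_bound n)) = (\<Sum>j\<in>{1..m}. ?c * (ennreal w * pair_bound n))"
    unfolding mult.assoc[symmetric, of 2] half by (simp add: ac_simps)
  also have "\<dots> \<le> (\<Sum>j\<in>{1..m}. 2 * (\<Sum>\<sigma>\<in>sign_vectors m. ?e j \<sigma>))"
    using sum_excess_ge[OF w p0 _ ghat] by (intro sum_mono) auto
  also have "\<dots> = 2 * (\<Sum>\<sigma>\<in>sign_vectors m. \<Sum>j\<in>{1..m}. ?e j \<sigma>)"
    by (subst sum.swap) (simp add: sum_distrib_left)
  also have "\<dots> \<le> 2 * (\<Sum>\<sigma>\<in>sign_vectors m. K)"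
    using K by (intro mult_left_mono sum_mono) auto
  also have "\<dots> = ?c * (2 * K)" by (simp add: ac_simps)
  finally have "?c * (2 * (ennreal (real m * w / 2) * pair_bound n)) \<le> ?c * (2 * K)" .
  then have "2 * (ennreal (real m * w / 2) * pair_bound n) \<le> 2 * K"
    using card_sign_vectors by (subst (asm) ennreal_mult_le_mult_iff) (auto simp: ennreal_of_nat_eq_real_of_nat)
  then show ?thesis
    by (subst (asm) ennreal_mult_le_mult_iff) auto
qed

text \<open>With \<open>0 < w\<close> and absolute continuity, \<open>p Minus\<close> is positive
  and the averaged bound applies. In every other case the similarity is 0, which is below the
  nonnegative excess.\<close>

lemma similarity_le_worst_excess:
  assumes n: "1 \<le> n" and ghat: "estimator M N n ghat"
    and S: "\<And>\<sigma>. \<sigma> \<in> sign_vectors m \<Longrightarrow> expected_risk loss (P \<sigma>) n ghat - optimal_risk M N loss (P \<sigma>) \<le> S"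
  shows "ereal (sim n) \<le> S"
proof -
  have S0: "0 \<le> S"
    using order_trans[OF expected_excess_nonneg[OF const_sign_vector ghat] S[OF const_sign_vector]] .
  show ?thesis
  proof (cases "0 < w \<and> absolutely_continuous (training_distr n (rep Minus)) (training_distr n (rep Plus))")
    case True
    then have w: "0 < w" by simp
    have p0: "0 < p Minus" using not_absolutely_continuous[OF w _ n] True p(1) by (auto simp: le_less)
    have "(\<Sum>j\<in>{1..m}. \<integral>\<^sup>+z. edge_excess j (\<sigma> j) (ghat z) \<partial>training_distr n (P \<sigma>)) \<le> e2ennreal S"
      if "\<sigma> \<in> sign_vectors m" for \<sigma>
      using e2ennreal_mono[OF order_trans[OF expected_excess_ge[OF w that ghat] S[OF that]]] by simp
    then have "ennreal (sim n) \<le> e2ennreal S"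
      using similarity_le[OF w p0] True pair_bound_le[OF w p0 ghat] by (meson order_trans)
    then have "enn2ereal (ennreal (sim n)) \<le> enn2ereal (e2ennreal S)" by (simp add: less_eq_ennreal.rep_eq)
    then have "enn2ereal (ennreal (sim n)) \<le> S" using S0 by (simp add: enn2ereal_e2ennreal)
    \<comment> \<open>Truncation at 0 can only raise \<open>sim n\<close>, whose sign is not
      established here.\<close>
    moreover have "ereal (sim n) \<le> enn2ereal (ennreal (sim n))"
      by (cases "0 \<le> sim n") (auto simp: ennreal_neg zero_ennreal.rep_eq)
    ultimately show ?thesis by (rule order_trans[rotated])
  next
    case False
    have "w = 0 \<or> 0 < w" using measure_nonneg[of \<mu> "X 1"] by linarith
    \<comment> \<open>With \<open>w = 0\<close> the characteristic function vanishes identically;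
      without absolute continuity the similarity is its value at 0, where the terms of
      \<open>psi\<close> cancel.\<close>
    then have "sim n = 0"
      using False by (auto simp: similarity_def characteristic_function_def psi_def)
    then show ?thesis using S0 by (simp add: zero_ereal_def)
  qed
qed

end

theorem theorem8p1:
  fixes M :: "'x measure" and N :: "'y measure"
    and loss :: "'y \<Rightarrow> 'y \<Rightarrow> real"
    and \<P> :: "('x \<times> 'y) measure set"
    and P :: "(nat \<Rightarrow> sign) \<Rightarrow> ('x \<times> 'y) measure"
    and \<mu> :: "'x measure" and \<X> :: "nat \<Rightarrow> 'x set" and h1 h2 :: 'y and p :: "sign \<Rightarrow> real"
    and P0 :: "('x \<times> 'y) measure"
    and m n :: nat
    and ghat :: "(nat \<Rightarrow> 'x \<times> 'y) \<Rightarrow> 'x \<Rightarrow> 'y"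
  assumes "(\<lambda>(y, y'). loss y y') \<in> borel_measurable (N \<Otimes>\<^sub>M N)"
    and "\<P> \<subseteq> space (prob_algebra (M \<Otimes>\<^sub>M N))"
    and "\<And>Q. Q \<in> \<P> \<Longrightarrow> excess_risk_well_defined M N loss Q"
    and "hypercube M N m P \<mu> \<X> h1 h2 p"
    and "\<And>\<sigma>. \<sigma> \<in> sign_vectors m \<Longrightarrow> P \<sigma> \<in> \<P>"
    and "is_base M N \<mu> \<X> h1 h2 P0"
    and "1 \<le> n"
    and "estimator M N n ghat"
  shows "(SUP Q\<in>\<P>. expected_risk loss Q n ghat - optimal_risk M N loss Q) \<ge>
    ereal (similarity
      (characteristic_function N loss m (edge_probability \<mu> \<X>) h1 h2 p)
      (training_distr n (representative \<X> h1 h2 p P0 Plus))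
      (training_distr n (representative \<X> h1 h2 p P0 Minus)))"
proof -
  have P: "\<forall>\<sigma> \<in> sign_vectors m. P \<sigma> \<in> space (prob_algebra (M \<Otimes>\<^sub>M N)) \<and> distr (P \<sigma>) M fst = \<mu>"
    and \<X>: "\<forall>j\<le>m. \<X> j \<in> sets M" "\<forall>j\<in>{1..m}. measure \<mu> (\<X> j) = measure \<mu> (\<X> 1)"
    and simple: "1 \<le> m" "disjoint_family_on \<X> {..m}" "(\<Union>j\<le>m. \<X> j) = space M"
      "h1 \<in> space N" "h2 \<in> space N" "h1 \<noteq> h2" "{h1} \<in> sets N" "{h2} \<in> sets N"
      "0 \<le> p Minus" "p Minus < p Plus" "p Plus \<le> 1"
    and ex: "\<exists>\<kappa>. (\<forall>\<sigma> \<in> sign_vectors m. is_cond_distr M N (P \<sigma>) (\<kappa> \<sigma>)) \<and>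
          (\<forall>\<sigma> \<in> sign_vectors m. \<forall>j\<in>{1..m}. \<forall>x \<in> \<X> j.
             measure (\<kappa> \<sigma> x) {h1} = p (\<sigma> j) \<and> p (\<sigma> j) = 1 - measure (\<kappa> \<sigma> x) {h2}) \<and>
          (\<forall>\<sigma> \<in> sign_vectors m. \<forall>\<tau> \<in> sign_vectors m. \<forall>x \<in> \<X> 0. \<kappa> \<sigma> x = \<kappa> \<tau> x)"
    using assms(4) unfolding hypercube_def by - (elim conjE, assumption)+
  from ex obtain \<kappa> where \<kappa>: "\<forall>\<sigma> \<in> sign_vectors m. is_cond_distr M N (P \<sigma>) (\<kappa> \<sigma>)"
    "\<forall>\<sigma> \<in> sign_vectors m. \<forall>j\<in>{1..m}. \<forall>x \<in> \<X> j.
       measure (\<kappa> \<sigma> x) {h1} = p (\<sigma> j) \<and> p (\<sigma> j) = 1 - measure (\<kappa> \<sigma> x) {h2}"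
    "\<forall>\<sigma> \<in> sign_vectors m. \<forall>\<tau> \<in> sign_vectors m. \<forall>x \<in> \<X> 0. \<kappa> \<sigma> x = \<kappa> \<tau> x"
    by (elim exE conjE)
  from assms(6) obtain \<kappa>0 where base: "P0 \<in> space (prob_algebra (M \<Otimes>\<^sub>M N))" "distr P0 M fst = \<mu>"
    "is_cond_distr M N P0 \<kappa>0"
    "\<forall>x \<in> space M - \<X> 0. measure (\<kappa>0 x) {h1} = 1 / 2 \<and> measure (\<kappa>0 x) {h2} = 1 / 2"
    unfolding is_base_def by (elim exE conjE)
  interpret assouad_hypercube_base M N loss m P \<mu> \<X> h1 h2 p \<kappa> P0 \<kappa>0
  proof
    show "excess_risk_well_defined M N loss (P \<sigma>)" if "\<sigma> \<in> sign_vectors m" for \<sigma>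
      using assms(3,5) that by blast
    show "P \<sigma> \<in> space (prob_algebra (M \<Otimes>\<^sub>M N))" "distr (P \<sigma>) M fst = \<mu>" "is_cond_distr M N (P \<sigma>) (\<kappa> \<sigma>)"
      if "\<sigma> \<in> sign_vectors m" for \<sigma>
      using P \<kappa>(1) that by auto
    show "\<X> j \<in> sets M" if "j \<le> m" for j
      using \<X>(1) that by blast
    show "measure \<mu> (\<X> j) = measure \<mu> (\<X> 1)" if "j \<in> {1..m}" for j
      using \<X>(2) that by blast
    show "measure (\<kappa> \<sigma> x) {h1} = p (\<sigma> j) \<and> p (\<sigma> j) = 1 - measure (\<kappa> \<sigma> x) {h2}"
      if "\<sigma> \<in> sign_vectors m" "j \<in> {1..m}" "x \<in> \<X> j" for \<sigma> j x
      using \<kappa>(2) that by blast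
    show "\<kappa> \<sigma> x = \<kappa> \<tau> x" if "\<sigma> \<in> sign_vectors m" "\<tau> \<in> sign_vectors m" "x \<in> \<X> 0" for \<sigma> \<tau> x
      using \<kappa>(3) that by blast
    show "measure (\<kappa>0 x) {h1} = 1 / 2 \<and> measure (\<kappa>0 x) {h2} = 1 / 2" if "x \<in> space M - \<X> 0" for x
      using base(4) that by blast
  qed (fact assms(1) simple base(1-3))+
  \<comment> \<open>All vertices lie in \<open>\<P>\<close>, so the supremum is an admissible
    \<open>S\<close>.\<close>
  show ?thesis
    unfolding edge_probability_def
    by (rule similarity_le_worst_excess[OF assms(7,8)]) (rule SUP_upper[OF assms(5)])
qed

end
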